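(* Let $p\in[1,\infty]$. There is an algorithm which, given integers $1\le k\le m\le n$ and a matrix $A\in\mathbb{R}^{n\times m}$, runs in time $m^k\,\mathrm{poly}(nm)$ and outputs $U\in\mathbb{R}^{n\times k}$ and $V\in\mathbb{R}^{k\times m}$ with $$|A-UV|_p\le (k+1)\,\mathrm{opt}_{k,p}(A).$$ Specifically, this holds for the following enumeration algorithm: for every $k$-element subset $I$ of $\{1,\dots,m\}$, set $U=A_I$ and compute a matrix $V\in\mathbb{R}^{k\times m}$ minimizing $d_I=|A-UV|_p$; return the pair $(U,V)$ with the smallest $d_I$ over all $I$.
   Context: For a matrix $M$, $|M|_p=\left(\sum_{i,j}|M_{i,j}|^p\right)^{1/p}$ is the entrywise $\ell_p$ norm for $1\le p<\infty$, and $|M|_\infty=\max_{i,j}|M_{i,j}|$. $A_I$ is the submatrix of $A$ consisting of the columns with indices in $I$. The quantity $\mathrm{opt}_{k,p}(A)$ is the minimum of $|A-U'V'|_p$ over all $U'\in\mathbb{R}^{n\times k}$, $V'\in\mathbb{R}^{k\times m}$. By convention, $\ell_p$ regression (given $U\in\mathbb{R}^{n\times k}$ and $v\in\mathbb{R}^n$, find $y\in\mathbb{R}^k$ minimizing $|Uy-v|_p$), being a convex program, is regarded as solvable in polynomial time. *)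

theory Defs
  imports
    Jordan_Normal_Form.DL_Submatrix
    "HOL-Library.Extended_Real"
    "HOL-Computational_Algebra.Polynomial"
begin

section \<open>Entrywise norms, optimal rank-k error, regression\<close>

definition lp_norm :: "ereal \<Rightarrow> 'i set \<Rightarrow> ('i \<Rightarrow> real) \<Rightarrow> real" where
  "lp_norm p S f =
     (if p = \<infinity> then Max ((\<lambda>i. \<bar>f i\<bar>) ` S)
      else (\<Sum>i\<in>S. \<bar>f i\<bar> powr real_of_ereal p) powr (1 / real_of_ereal p))"

definition mat_norm :: "ereal \<Rightarrow> real mat \<Rightarrow> real" where
  "mat_norm p M = lp_norm p ({..<dim_row M} \<times> {..<dim_col M}) (\<lambda>ij. M $$ ij)"

definition vec_norm :: "ereal \<Rightarrow> real vec \<Rightarrow> real" where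
  "vec_norm p v = lp_norm p {..<dim_vec v} (\<lambda>i. v $ i)"

text \<open>The minimum is attained because the matrices of rank at most \<open>k\<close> form a closed set,
  so the infimum below is that minimum.\<close>

definition opt :: "nat \<Rightarrow> ereal \<Rightarrow> real mat \<Rightarrow> real" where
  "opt k p A = Inf {mat_norm p (A - U * V) | U V.
     U \<in> carrier_mat (dim_row A) k \<and> V \<in> carrier_mat k (dim_col A)}"

definition columns :: "real mat \<Rightarrow> nat set \<Rightarrow> real mat" where
  "columns A I = submatrix A UNIV I"

definition regression_solver :: "ereal \<Rightarrow> (real mat \<Rightarrow> real vec \<Rightarrow> real vec) \<Rightarrow> bool" where
  "regression_solver p reg \<longleftrightarrow>
     (\<forall>n k U v. 0 < n \<longrightarrow> 0 < k \<longrightarrow> U \<in> carrier_mat n k \<longrightarrow> v \<in> carrier_vec n \<longrightarrow>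
        is_arg_min (\<lambda>y. vec_norm p (U *\<^sub>v y - v)) (\<lambda>y. y \<in> carrier_vec k) (reg U v))"

text \<open>The size of a regression instance is the number of its real entries.\<close>

definition polynomial_time_regression :: "(real mat \<Rightarrow> real vec \<Rightarrow> nat) \<Rightarrow> bool" where
  "polynomial_time_regression reg_time \<longleftrightarrow>
     (\<exists>q :: nat poly. \<forall>n k U v. 0 < n \<longrightarrow> 0 < k \<longrightarrow>
        U \<in> carrier_mat n k \<longrightarrow> v \<in> carrier_vec n \<longrightarrow> reg_time U v \<le> poly q (n * k + n))"


section \<open>The possible outputs of the enumeration, over all choices of minimizers\<close>

text \<open>\<open>F I\<close> is the minimizer chosen for the index set \<open>I\<close>, and \<open>J\<close> is an index set of smallest
  error; ties may be broken in any way. Column indices are counted from 0.\<close>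

definition enumeration_output :: "nat \<Rightarrow> ereal \<Rightarrow> real mat \<Rightarrow> real mat \<Rightarrow> real mat \<Rightarrow> bool" where
  "enumeration_output k p A U V \<longleftrightarrow>
     (\<exists>F J.
        (\<forall>I. I \<subseteq> {..<dim_col A} \<and> card I = k \<longrightarrow>
           is_arg_min (\<lambda>W. mat_norm p (A - columns A I * W))
             (\<lambda>W. W \<in> carrier_mat k (dim_col A)) (F I)) \<and>
        is_arg_min (\<lambda>I. mat_norm p (A - columns A I * F I))
          (\<lambda>I. I \<subseteq> {..<dim_col A} \<and> card I = k) J \<and>
        U = columns A J \<and> V = F J)"


section \<open>A real random access machine with a regression subroutine\<close>

text \<open>Programs work on named arrays of natural numbers and named two-dimensional arrays of reals;
  a scalar is the cell with all indices 0. Every operation costs one unit, except that a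
  regression call costs what the solver takes. Natural numbers can only be added and subtracted:
  with unit-cost multiplication short programs could create numbers of exponential length.\<close>

record store =
  nats :: "string \<Rightarrow> nat \<Rightarrow> nat"
  reals :: "string \<Rightarrow> nat \<Rightarrow> nat \<Rightarrow> real"

datatype nexp =
    NConst nat
  | NCell string nexp
  | NPlus nexp nexp
  | NMinus nexp nexp

datatype rexp =
    RConst real
  | RCell string nexp nexp
  | RPlus rexp rexp
  | RMinus rexp rexp
  | RTimes rexp rexp
  | RAbs rexp
  | RPowr rexp rexp

datatype bexp =
    NLess nexp nexp
  | NEq nexp nexp
  | RLess rexp rexp
  | BNot bexp
  | BOr bexp bexp

text \<open>\<open>Regress Y M B n k c\<close> runs the solver on the leading \<open>n \<times> k\<close> block of \<open>M\<close> and the first \<open>n\<close>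
  entries of column \<open>c\<close> of \<open>B\<close>, and writes the solution to the first \<open>k\<close> entries of column \<open>c\<close>
  of \<open>Y\<close>.\<close>

datatype com =
    Skip
  | NSet string nexp nexp
  | RSet string nexp nexp rexp
  | Seq com com  (infixr \<open>;;\<close> 60)
  | Cond bexp com com
  | For string nexp com
  | Regress string string string nexp nexp nexp

primrec nval :: "nexp \<Rightarrow> store \<Rightarrow> nat" where
  "nval (NConst a) s = a"
| "nval (NCell x e) s = nats s x (nval e s)"
| "nval (NPlus e f) s = nval e s + nval f s"
| "nval (NMinus e f) s = nval e s - nval f s"

primrec ncost :: "nexp \<Rightarrow> nat" where
  "ncost (NConst a) = 1"
| "ncost (NCell x e) = 1 + ncost e"
| "ncost (NPlus e f) = 1 + ncost e + ncost f"
| "ncost (NMinus e f) = 1 + ncost e + ncost f"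

primrec rval :: "rexp \<Rightarrow> store \<Rightarrow> real" where
  "rval (RConst a) s = a"
| "rval (RCell X e f) s = reals s X (nval e s) (nval f s)"
| "rval (RPlus e f) s = rval e s + rval f s"
| "rval (RMinus e f) s = rval e s - rval f s"
| "rval (RTimes e f) s = rval e s * rval f s"
| "rval (RAbs e) s = \<bar>rval e s\<bar>"
| "rval (RPowr e f) s = rval e s powr rval f s"

primrec rcost :: "rexp \<Rightarrow> nat" where
  "rcost (RConst a) = 1"
| "rcost (RCell X e f) = 1 + ncost e + ncost f"
| "rcost (RPlus e f) = 1 + rcost e + rcost f"
| "rcost (RMinus e f) = 1 + rcost e + rcost f"
| "rcost (RTimes e f) = 1 + rcost e + rcost f"
| "rcost (RAbs e) = 1 + rcost e"
| "rcost (RPowr e f) = 1 + rcost e + rcost f"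

primrec bval :: "bexp \<Rightarrow> store \<Rightarrow> bool" where
  "bval (NLess e f) s \<longleftrightarrow> nval e s < nval f s"
| "bval (NEq e f) s \<longleftrightarrow> nval e s = nval f s"
| "bval (RLess e f) s \<longleftrightarrow> rval e s < rval f s"
| "bval (BNot b) s \<longleftrightarrow> \<not> bval b s"
| "bval (BOr b c) s \<longleftrightarrow> bval b s \<or> bval c s"

primrec bcost :: "bexp \<Rightarrow> nat" where
  "bcost (NLess e f) = 1 + ncost e + ncost f"
| "bcost (NEq e f) = 1 + ncost e + ncost f"
| "bcost (RLess e f) = 1 + rcost e + rcost f"
| "bcost (BNot b) = 1 + bcost b"
| "bcost (BOr b c) = 1 + bcost b + bcost c"

definition nset :: "string \<Rightarrow> nat \<Rightarrow> nat \<Rightarrow> store \<Rightarrow> store" where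
  "nset x i a s = s\<lparr>nats := (nats s)(x := (nats s x)(i := a))\<rparr>"

definition rset :: "string \<Rightarrow> nat \<Rightarrow> nat \<Rightarrow> real \<Rightarrow> store \<Rightarrow> store" where
  "rset X i j a s =
     s\<lparr>reals := (reals s)(X := (reals s X)(i := (reals s X i)(j := a)))\<rparr>"

definition block :: "store \<Rightarrow> string \<Rightarrow> nat \<Rightarrow> nat \<Rightarrow> real mat" where
  "block s X n m = mat n m (\<lambda>(i, j). reals s X i j)"

definition col_block :: "store \<Rightarrow> string \<Rightarrow> nat \<Rightarrow> nat \<Rightarrow> real vec" where
  "col_block s X n c = vec n (\<lambda>i. reals s X i c)"

definition set_col :: "string \<Rightarrow> nat \<Rightarrow> nat \<Rightarrow> real vec \<Rightarrow> store \<Rightarrow> store" where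
  "set_col X k c y s =
     s\<lparr>reals := (reals s)(X :=
        (\<lambda>i j. if i < k \<and> j = c then y $ i else reals s X i j))\<rparr>"

text \<open>\<open>exec\<close> returns the final store together with the running time. The bound of a \<open>For\<close> loop is
  evaluated once, on entry, and the loop variable then runs from 0 up to it, exclusively.\<close>

primrec exec ::
  "(real mat \<Rightarrow> real vec \<Rightarrow> real vec) \<Rightarrow> (real mat \<Rightarrow> real vec \<Rightarrow> nat) \<Rightarrow>
   com \<Rightarrow> store \<Rightarrow> store \<times> nat" where
  "exec reg reg_time Skip s = (s, 1)"
| "exec reg reg_time (NSet x e f) s =
     (nset x (nval e s) (nval f s) s, 1 + ncost e + ncost f)"
| "exec reg reg_time (RSet X e f r) s =
     (rset X (nval e s) (nval f s) (rval r s) s, 1 + ncost e + ncost f + rcost r)"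
| "exec reg reg_time (c ;; d) s =
     (let (s1, t1) = exec reg reg_time c s; (s2, t2) = exec reg reg_time d s1
      in (s2, t1 + t2))"
| "exec reg reg_time (Cond b c d) s =
     (let (s1, t1) = (if bval b s then exec reg reg_time c s else exec reg reg_time d s)
      in (s1, 1 + bcost b + t1))"
| "exec reg reg_time (For x e c) s =
     fold (\<lambda>i (s', t). let (s1, t1) = exec reg reg_time c (nset x 0 i s') in (s1, t + 1 + t1))
       [0..<nval e s] (s, 1 + ncost e)"
| "exec reg reg_time (Regress Y M B en ek ec) s =
     (let n = nval en s; k = nval ek s; c = nval ec s;
          U = block s M n k; v = col_block s B n c
      in (set_col Y k c (reg U v) s, 1 + ncost en + ncost ek + ncost ec + reg_time U v))"


section \<open>The enumeration algorithm\<close>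

abbreviation N0 :: nexp where "N0 \<equiv> NConst 0"
abbreviation N1 :: nexp where "N1 \<equiv> NConst 1"
abbreviation nvar :: "string \<Rightarrow> nexp" where "nvar x \<equiv> NCell x N0"
abbreviation rvar :: "string \<Rightarrow> rexp" where "rvar X \<equiv> RCell X N0 N0"
abbreviation nassign :: "string \<Rightarrow> nexp \<Rightarrow> com"  (infix \<open>:=\<^sub>N\<close> 61) where
  "x :=\<^sub>N e \<equiv> NSet x N0 e"
abbreviation rassign :: "string \<Rightarrow> rexp \<Rightarrow> com"  (infix \<open>:=\<^sub>R\<close> 61) where
  "X :=\<^sub>R r \<equiv> RSet X N0 N0 r"

definition copy_array :: "string \<Rightarrow> string \<Rightarrow> nexp \<Rightarrow> nexp \<Rightarrow> com" where
  "copy_array Y X e f =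
     For ''i'' e (For ''j'' f
       (RSet Y (nvar ''i'') (nvar ''j'') (RCell X (nvar ''i'') (nvar ''j''))))"

text \<open>Computes \<open>''count'' = m ^ k\<close>.\<close>

definition count_tuples :: com where
  "count_tuples =
     ''count'' :=\<^sub>N N1 ;;
     For ''i'' (nvar ''k'')
       (''sum'' :=\<^sub>N N0 ;;
        For ''j'' (nvar ''m'') (''sum'' :=\<^sub>N NPlus (nvar ''sum'') (nvar ''count'')) ;;
        ''count'' :=\<^sub>N nvar ''sum'')"

text \<open>The array \<open>''D''\<close> holds a tuple of \<open>k\<close> column indices, read as the base-\<open>m\<close> digits of a
  counter. It represents the index set \<open>I\<close> iff it is strictly increasing.\<close>

definition next_tuple :: com where
  "next_tuple =
     ''carry'' :=\<^sub>N N1 ;;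
     For ''j'' (nvar ''k'')
       (Cond (NEq (nvar ''carry'') N1)
          (NSet ''D'' (nvar ''j'') (NPlus (NCell ''D'' (nvar ''j'')) N1) ;;
           Cond (NEq (NCell ''D'' (nvar ''j'')) (nvar ''m''))
             (NSet ''D'' (nvar ''j'') N0)
             (''carry'' :=\<^sub>N N0))
          Skip)"

definition test_increasing :: com where
  "test_increasing =
     ''ok'' :=\<^sub>N N1 ;;
     For ''j'' (NMinus (nvar ''k'') N1)
       (Cond (NLess (NCell ''D'' (nvar ''j'')) (NCell ''D'' (NPlus (nvar ''j'') N1)))
          Skip
          (''ok'' :=\<^sub>N N0))"

definition select_columns :: com where
  "select_columns =
     For ''i'' (nvar ''n'') (For ''j'' (nvar ''k'')
       (RSet ''U'' (nvar ''i'') (nvar ''j'')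
          (RCell ''A'' (nvar ''i'') (NCell ''D'' (nvar ''j'')))))"

definition regress_columns :: com where
  "regress_columns =
     For ''c'' (nvar ''m'')
       (Regress ''V'' ''U'' ''A'' (nvar ''n'') (nvar ''k'') (nvar ''c''))"

text \<open>Computes in \<open>''d''\<close> the norm of \<open>A - U V\<close>; \<open>p\<close> is a constant of the program.\<close>

definition compute_error :: "ereal \<Rightarrow> com" where
  "compute_error p =
     ''d'' :=\<^sub>R RConst 0 ;;
     For ''i'' (nvar ''n'') (For ''c'' (nvar ''m'')
       (''r'' :=\<^sub>R RCell ''A'' (nvar ''i'') (nvar ''c'') ;;
        For ''j'' (nvar ''k'')
          (''r'' :=\<^sub>R RMinus (rvar ''r'')
             (RTimes (RCell ''U'' (nvar ''i'') (nvar ''j'')) (RCell ''V'' (nvar ''j'') (nvar ''c'')))) ;;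
        (if p = \<infinity>
         then Cond (RLess (rvar ''d'') (RAbs (rvar ''r''))) (''d'' :=\<^sub>R RAbs (rvar ''r'')) Skip
         else ''d'' :=\<^sub>R RPlus (rvar ''d'')
                (RPowr (RAbs (rvar ''r'')) (RConst (real_of_ereal p)))))) ;;
     (if p = \<infinity> then Skip
      else ''d'' :=\<^sub>R RPowr (rvar ''d'') (RConst (1 / real_of_ereal p)))"

definition keep_best :: com where
  "keep_best =
     Cond (BOr (NEq (nvar ''found'') N0) (RLess (rvar ''d'') (rvar ''best'')))
       (''found'' :=\<^sub>N N1 ;;
        ''best'' :=\<^sub>R rvar ''d'' ;;
        copy_array ''Ubest'' ''U'' (nvar ''n'') (nvar ''k'') ;;
        copy_array ''Vbest'' ''V'' (nvar ''k'') (nvar ''m''))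
       Skip"

definition enumeration :: "ereal \<Rightarrow> com" where
  "enumeration p =
     count_tuples ;;
     For ''j'' (nvar ''k'') (NSet ''D'' (nvar ''j'') N0) ;;
     ''found'' :=\<^sub>N N0 ;;
     For ''x'' (nvar ''count'')
       (test_increasing ;;
        Cond (NEq (nvar ''ok'') N1)
          (select_columns ;; regress_columns ;; compute_error p ;; keep_best)
          Skip ;;
        next_tuple)"

definition input_store :: "nat \<Rightarrow> nat \<Rightarrow> nat \<Rightarrow> real mat \<Rightarrow> store" where
  "input_store n m k A =
     \<lparr>nats = (\<lambda>x i. 0)(''n'' := (\<lambda>i. n), ''m'' := (\<lambda>i. m), ''k'' := (\<lambda>i. k)),
      reals = (\<lambda>X i j. 0)(''A'' := (\<lambda>i j. if i < n \<and> j < m then A $$ (i, j) else 0))\<rparr>"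

end

theory Submission
  imports Defs "HOL-Analysis.Convex" "Jordan_Normal_Form.Char_Poly"
begin

text \<open>Let \<open>E = A - U' V'\<close>, let \<open>e\<^sub>j\<close> be the norms of its columns and put \<open>w\<^sub>j = e\<^sub>j + \<epsilon>\<close>. If \<open>V'\<close> has
  rank \<open>k\<close>, choose \<open>k\<close> columns of \<open>V'\<close> for which \<open>\<bar>det\<bar>\<close> divided by the product of the weights \<open>w\<close> is
  maximal. By Cramer's rule every column of \<open>V'\<close> is a combination \<open>\<Sum> c\<^sub>i V'\<^sub>i\<close> of the chosen ones with
  \<open>\<bar>c\<^sub>i\<bar> w\<^sub>i \<le> w\<^sub>j\<close>, so the same combination of columns of \<open>A\<close> approximates \<open>A\<^sub>j\<close> with error at most
  \<open>e\<^sub>j + \<Sum> \<bar>c\<^sub>i\<bar> e\<^sub>i \<le> (k + 1) w\<^sub>j\<close>. Adding a small multiple of the identity to a block of \<open>V'\<close> makes its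
  rank \<open>k\<close>, and both perturbations vanish in the limit.

  Since the norm of a matrix is determined monotonically by the norms of its columns, columnwise
  regression minimizes it. The program runs over all \<open>m\<^sup>k\<close> tuples of column indices, and the loops
  inside have bounds at most \<open>n m\<close>, so each round costs a polynomial in \<open>n m\<close>.\<close>

section \<open>Entrywise norms\<close>

text \<open>For positive \<open>x\<close> and \<open>y\<close> this is convexity of the power
  function. At a zero argument the power of the remaining product splits, and only
  \<open>s powr q \<le> s\<close> for \<open>s\<close> between 0 and 1 is left.\<close>

lemma powr_convex_nonneg:
  fixes q t x y :: real
  assumes "1 \<le> q" "0 \<le> t" "t \<le> 1" "0 \<le> x" "0 \<le> y"
  shows "(t * x + (1 - t) * y) powr q \<le> t * x powr q + (1 - t) * y powr q"
proof -
  have small: "s powr q \<le> s" if "0 \<le> s" "s \<le> 1" for s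
    using powr_mono'[of 1 q s] that assms(1) by (cases "s = 0") auto
  consider "x = 0" | "y = 0" | "0 < x" "0 < y" using assms by linarith
  then show ?thesis
  proof cases
    case 1
    then show ?thesis using assms small[of "1 - t"]
      by (auto simp: powr_mult intro: mult_right_mono)
  next
    case 2
    then show ?thesis using assms small[of t]
      by (auto simp: powr_mult intro: mult_right_mono)
  next
    case 3
    then show ?thesis using convex_onD[OF powr_convex[OF assms(1)], of "1 - t" x y] assms
      by simp
  qed
qed

text \<open>Divided by the norms \<open>a\<close> and \<open>b\<close>, both functions have norm 1,
  and \<open>(f + g) / (a + b)\<close> is their convex combination with weights
  \<open>a / (a + b)\<close> and \<open>b / (a + b)\<close>. Convexity at each point, summed over
  \<open>S\<close>, bounds its power sum by 1. If one norm is 0, that function vanishes on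
  \<open>S\<close>.\<close>

lemma Minkowski_inequality_powr:
  fixes q :: real and f g :: "'i \<Rightarrow> real"
  assumes q: "1 \<le> q" and S: "finite S" and f: "\<And>i. i \<in> S \<Longrightarrow> 0 \<le> f i" and g: "\<And>i. i \<in> S \<Longrightarrow> 0 \<le> g i"
  shows "(\<Sum>i\<in>S. (f i + g i) powr q) powr (1 / q)
    \<le> (\<Sum>i\<in>S. f i powr q) powr (1 / q) + (\<Sum>i\<in>S. g i powr q) powr (1 / q)"
proof -
  define F where "F = (\<Sum>i\<in>S. f i powr q)"
  define G where "G = (\<Sum>i\<in>S. g i powr q)"
  define a where "a = F powr (1 / q)"
  define b where "b = G powr (1 / q)"
  have FG: "0 \<le> F" "0 \<le> G" by (auto simp: F_def G_def intro: sum_nonneg)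
  have zero: "\<forall>i\<in>S. h i = 0" if "(\<Sum>i\<in>S. h i powr q) = 0" for h :: "'i \<Rightarrow> real"
    using that S by (subst (asm) sum_nonneg_eq_0_iff) auto
  consider "F = 0" | "G = 0" | "0 < F" "0 < G" using FG by linarith
  then show ?thesis
  proof cases
    case 1
    then have "\<forall>i\<in>S. f i = 0" using zero[of f] F_def by simp
    then show ?thesis by simp
  next
    case 2
    then have "\<forall>i\<in>S. g i = 0" using zero[of g] G_def by simp
    then show ?thesis by simp
  next
    case 3
    then have ab: "0 < a" "0 < b" by (auto simp: a_def b_def)
    have aq: "a powr q = F" "b powr q = G"
      using q 3 by (auto simp: a_def b_def powr_powr)
    define t where "t = a / (a + b)"
    have t: "0 \<le> t" "t \<le> 1" "1 - t = b / (a + b)"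
      using ab by (auto simp: t_def field_simps)
    have "(f i + g i) powr q \<le> (a + b) powr q * (t * (f i powr q / F) + (1 - t) * (g i powr q / G))"
      if "i \<in> S" for i
    proof -
      have "f i + g i = (a + b) * (t * (f i / a) + (1 - t) * (g i / b))"
      proof -
        have "(a + b) * t = a" "(a + b) * (1 - t) = b" using ab unfolding t(3) by (simp_all add: t_def)
        moreover have "(a + b) * (t * (f i / a) + (1 - t) * (g i / b))
            = ((a + b) * t) * (f i / a) + ((a + b) * (1 - t)) * (g i / b)"
          by (simp only: distrib_left mult.assoc)
        ultimately show ?thesis using ab by simp
      qed
      then have "(f i + g i) powr q = (a + b) powr q * (t * (f i / a) + (1 - t) * (g i / b)) powr q"
        using ab t f[OF that] g[OF that] by (simp add: powr_mult)
      also have "\<dots> \<le> (a + b) powr q * (t * (f i / a) powr q + (1 - t) * (g i / b) powr q)"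
        using ab t q f[OF that] g[OF that] by (intro mult_left_mono powr_convex_nonneg) auto
      also have "\<dots> = (a + b) powr q * (t * (f i powr q / F) + (1 - t) * (g i powr q / G))"
        using ab f[OF that] g[OF that] by (simp add: powr_divide aq)
      finally show ?thesis .
    qed
    then have "(\<Sum>i\<in>S. (f i + g i) powr q)
        \<le> (\<Sum>i\<in>S. (a + b) powr q * (t * (f i powr q / F) + (1 - t) * (g i powr q / G)))"
      by (rule sum_mono)
    also have "\<dots> = (a + b) powr q * (t * (F / F) + (1 - t) * (G / G))"
      unfolding F_def G_def by (simp only: sum_distrib_left[symmetric] sum.distrib sum_divide_distrib)
    also have "\<dots> = (a + b) powr q" using 3 by simp
    finally have "(\<Sum>i\<in>S. (f i + g i) powr q) powr (1 / q) \<le> ((a + b) powr q) powr (1 / q)"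
      using q by (intro powr_mono2) (auto intro: sum_nonneg)
    then show ?thesis using ab q by (simp add: powr_powr a_def b_def F_def G_def)
  qed
qed

lemma real_of_ereal_ge_1:
  assumes "1 \<le> p" "p \<noteq> \<infinity>"
  shows "1 \<le> real_of_ereal p"
  using assms by (cases p) (auto simp: one_ereal_def)

text \<open>The set has to be nonempty because \<open>Max {}\<close> is unspecified.\<close>

lemma lp_norm_nonneg:
  assumes "finite S" "S \<noteq> {}"
  shows "0 \<le> lp_norm p S f"
proof -
  obtain i where "i \<in> S" using assms by blast
  have "0 \<le> \<bar>f i\<bar>" by simp
  also have "\<bar>f i\<bar> \<le> Max ((\<lambda>i. \<bar>f i\<bar>) ` S)" using assms \<open>i \<in> S\<close> by auto
  finally show ?thesis by (simp add: lp_norm_def)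
qed

lemma lp_norm_cong: "(\<And>i. i \<in> S \<Longrightarrow> \<bar>f i\<bar> = \<bar>g i\<bar>) \<Longrightarrow> lp_norm p S f = lp_norm p S g"
  unfolding lp_norm_def by (simp cong: image_cong sum.cong)

lemma lp_norm_mono:
  assumes "1 \<le> p" "finite S" "S \<noteq> {}" "\<And>i. i \<in> S \<Longrightarrow> \<bar>f i\<bar> \<le> \<bar>g i\<bar>"
  shows "lp_norm p S f \<le> lp_norm p S g"
proof (cases "p = \<infinity>")
  case True
  have "\<bar>f i\<bar> \<le> Max ((\<lambda>i. \<bar>g i\<bar>) ` S)" if "i \<in> S" for i
    using assms(2) assms(4)[OF that] that by (intro order_trans[OF assms(4)[OF that]] Max_ge) auto
  then show ?thesis using True assms by (auto simp: lp_norm_def)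
next
  case False
  then show ?thesis using real_of_ereal_ge_1[OF assms(1)] assms
    by (auto simp: lp_norm_def intro!: powr_mono2 sum_mono sum_nonneg)
qed

lemma lp_norm_triangle:
  assumes "1 \<le> p" "finite S" "S \<noteq> {}"
  shows "lp_norm p S (\<lambda>i. f i + g i) \<le> lp_norm p S f + lp_norm p S g"
proof (cases "p = \<infinity>")
  case True
  have "\<bar>f i + g i\<bar> \<le> Max ((\<lambda>i. \<bar>f i\<bar>) ` S) + Max ((\<lambda>i. \<bar>g i\<bar>) ` S)" if "i \<in> S" for i
    using assms(2) that by (intro order_trans[OF abs_triangle_ineq] add_mono Max_ge) auto
  then show ?thesis using True assms by (auto simp: lp_norm_def)
next
  case False
  note q = real_of_ereal_ge_1[OF assms(1) False]
  have "(\<Sum>i\<in>S. \<bar>f i + g i\<bar> powr real_of_ereal p) powr (1 / real_of_ereal p)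
    \<le> (\<Sum>i\<in>S. (\<bar>f i\<bar> + \<bar>g i\<bar>) powr real_of_ereal p) powr (1 / real_of_ereal p)"
    using q by (intro powr_mono2 sum_mono sum_nonneg) auto
  also have "\<dots> \<le> (\<Sum>i\<in>S. \<bar>f i\<bar> powr real_of_ereal p) powr (1 / real_of_ereal p)
      + (\<Sum>i\<in>S. \<bar>g i\<bar> powr real_of_ereal p) powr (1 / real_of_ereal p)"
    using q assms by (intro Minkowski_inequality_powr) auto
  finally show ?thesis using False by (simp add: lp_norm_def)
qed

lemma lp_norm_scale:
  assumes "1 \<le> p" "finite S" "S \<noteq> {}"
  shows "lp_norm p S (\<lambda>i. c * f i) = \<bar>c\<bar> * lp_norm p S f"
proof (cases "p = \<infinity>")
  case True
  have "Max ((\<lambda>i. \<bar>c\<bar> * \<bar>f i\<bar>) ` S) = \<bar>c\<bar> * Max ((\<lambda>i. \<bar>f i\<bar>) ` S)"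
    using mono_Max_commute[of "\<lambda>x. \<bar>c\<bar> * x" "(\<lambda>i. \<bar>f i\<bar>) ` S"] assms
    by (auto simp: image_image mono_def mult_left_mono)
  then show ?thesis using True by (simp add: lp_norm_def abs_mult)
next
  case False
  note q = real_of_ereal_ge_1[OF assms(1) False]
  show ?thesis using False q
    by (simp add: lp_norm_def abs_mult powr_mult powr_powr sum_nonneg flip: sum_distrib_left)
qed

lemma lp_norm_sum:
  assumes "1 \<le> p" "finite S" "S \<noteq> {}" "finite T"
  shows "lp_norm p S (\<lambda>i. \<Sum>t\<in>T. f t i) \<le> (\<Sum>t\<in>T. lp_norm p S (f t))"
  using assms(4)
proof induction
  case empty
  \<comment> \<open>Scaling by the factor 0 shows that the zero function has norm 0.\<close>
  show ?case using lp_norm_scale[OF assms(1-3), of 0 "\<lambda>_. 0"] by simp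
next
  case (insert t T)
  then show ?case using lp_norm_triangle[OF assms(1-3), of "f t" "\<lambda>i. \<Sum>t\<in>T. f t i"] by simp
qed

text \<open>The inner root cancels against the outer power; for \<open>p = \<infinity>\<close> a
  maximum is taken in two stages. The outer norm puts absolute values around the inner norms, which
  changes nothing as these are nonnegative.\<close>

lemma lp_norm_Times:
  assumes "1 \<le> p" "finite S" "S \<noteq> {}" "finite T" "T \<noteq> {}"
  shows "lp_norm p (S \<times> T) f = lp_norm p T (\<lambda>j. lp_norm p S (\<lambda>i. f (i, j)))"
proof (cases "p = \<infinity>")
  case True
  have nn: "\<bar>Max ((\<lambda>i. \<bar>f (i, j)\<bar>) ` S)\<bar> = Max ((\<lambda>i. \<bar>f (i, j)\<bar>) ` S)" for j
    using lp_norm_nonneg[OF assms(2,3), of p "\<lambda>i. f (i, j)"] True by (simp add: lp_norm_def)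
  have "Max ((\<lambda>ij. \<bar>f ij\<bar>) ` (S \<times> T)) = Max ((\<lambda>j. Max ((\<lambda>i. \<bar>f (i, j)\<bar>) ` S)) ` T)"
  proof (rule antisym)
    show "Max ((\<lambda>ij. \<bar>f ij\<bar>) ` (S \<times> T)) \<le> Max ((\<lambda>j. Max ((\<lambda>i. \<bar>f (i, j)\<bar>) ` S)) ` T)"
    proof (rule Max.boundedI)
      fix a assume "a \<in> (\<lambda>ij. \<bar>f ij\<bar>) ` (S \<times> T)"
      then obtain i j where ij: "i \<in> S" "j \<in> T" "a = \<bar>f (i, j)\<bar>" by auto
      then have "a \<le> Max ((\<lambda>i. \<bar>f (i, j)\<bar>) ` S)" using assms by auto
      also have "\<dots> \<le> Max ((\<lambda>j. Max ((\<lambda>i. \<bar>f (i, j)\<bar>) ` S)) ` T)" using ij assms by (intro Max_ge) auto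
      finally show "a \<le> \<dots>" .
    qed (use assms in auto)
    show "Max ((\<lambda>j. Max ((\<lambda>i. \<bar>f (i, j)\<bar>) ` S)) ` T) \<le> Max ((\<lambda>ij. \<bar>f ij\<bar>) ` (S \<times> T))"
      using assms by (auto intro!: Max.boundedI Max_ge)
  qed
  then show ?thesis using True by (simp add: lp_norm_def nn)
next
  case False
  note q = real_of_ereal_ge_1[OF assms(1) False]
  show ?thesis using False q
    by (simp add: lp_norm_def powr_powr sum_nonneg sum.cartesian_product'[of _ S T] sum.swap[of _ T S])
qed

section \<open>Approximation by columns\<close>

text \<open>The product of \<open>M\<close> with its adjugate is \<open>det M\<close> times the
  identity, so the adjugate applied to \<open>b / det M\<close> is a solution.\<close>

lemma nonsingular_solve:
  fixes M :: "real mat"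
  assumes M: "M \<in> carrier_mat k k" and det: "det M \<noteq> 0" and b: "b \<in> carrier_vec k"
  shows "\<exists>x \<in> carrier_vec k. M *\<^sub>v x = b"
proof
  note adj = adj_mat[OF M]
  define y where "y = (1 / det M) \<cdot>\<^sub>v b"
  have y: "y \<in> carrier_vec k" using b by (simp add: y_def)
  show "adj_mat M *\<^sub>v y \<in> carrier_vec k" by (rule mult_mat_vec_carrier[OF adj(1) y])
  have "M *\<^sub>v (adj_mat M *\<^sub>v y) = (det M \<cdot>\<^sub>m 1\<^sub>m k) *\<^sub>v y"
    using assoc_mult_mat_vec[OF M adj(1) y] adj(2) by simp
  also have "\<dots> = det M \<cdot>\<^sub>v y"
  proof (rule eq_vecI)
    fix i assume "i < dim_vec (det M \<cdot>\<^sub>v y)"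
    then have i: "i < k" using y by simp
    have "((det M \<cdot>\<^sub>m 1\<^sub>m k) *\<^sub>v y) $ i = row (det M \<cdot>\<^sub>m 1\<^sub>m k) i \<bullet> y"
      using i by simp
    also have "\<dots> = (\<Sum>j\<in>{0..<k}. if i = j then det M * y $ j else 0)"
      unfolding scalar_prod_def using i y by (intro sum.cong) auto
    also have "\<dots> = (det M \<cdot>\<^sub>v y) $ i" using i y by simp
    finally show "((det M \<cdot>\<^sub>m 1\<^sub>m k) *\<^sub>v y) $ i = (det M \<cdot>\<^sub>v y) $ i" .
  qed (use y in simp)
  also have "\<dots> = b" using det b by (simp add: y_def smult_smult_assoc)
  finally show "M *\<^sub>v (adj_mat M *\<^sub>v y) = b" .
qed

text \<open>Columns are listed by a map, not collected in a set as in \<open>columns\<close>: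
  exchanging one of them then leaves the positions of the others fixed.\<close>

definition choose_columns :: "nat \<Rightarrow> (nat \<Rightarrow> nat) \<Rightarrow> real mat \<Rightarrow> real mat" where
  "choose_columns k d V = mat k k (\<lambda>(i, l). V $$ (i, d l))"

text \<open>The columns are those maximizing \<open>\<bar>det\<bar> / \<Prod> w\<close>; by Cramer's rule, the coefficients of
  every other column are quotients of two such determinants.\<close>

lemma max_volume_columns:
  fixes V :: "real mat" and w :: "nat \<Rightarrow> real"
  assumes w: "\<And>j. j < m \<Longrightarrow> 0 < w j"
    and d0: "d0 \<in> {..<k} \<rightarrow>\<^sub>E {..<m}" "det (choose_columns k d0 V) \<noteq> 0"
  obtains d c where "d \<in> {..<k} \<rightarrow>\<^sub>E {..<m}" "inj_on d {..<k}"
    "\<forall>i<k. \<forall>j<m. V $$ (i, j) = (\<Sum>l<k. V $$ (i, d l) * c l j)"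
    "\<forall>l<k. \<forall>j<m. \<bar>c l j\<bar> * w (d l) \<le> w j"
proof -
  define vol where "vol d = \<bar>det (choose_columns k d V)\<bar> / (\<Prod>l<k. w (d l))" for d
  let ?D = "{..<k} \<rightarrow>\<^sub>E {..<m}"
  have "finite (vol ` ?D)" "vol ` ?D \<noteq> {}" using d0(1) by (auto intro!: finite_PiE)
  from Max_in[OF this] obtain d where d: "d \<in> ?D" "vol d = Max (vol ` ?D)" by auto
  have max: "vol d' \<le> vol d" if "d' \<in> ?D" for d'
    unfolding d(2) by (rule Max_ge) (use that in \<open>auto intro!: finite_PiE\<close>)
  have pos: "0 < (\<Prod>l<k. w (d' l))" if "d' \<in> ?D" for d'
    using that w by (intro prod_pos) auto
  have "0 < vol d0" using pos[OF d0(1)] d0(2) by (simp add: vol_def)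
  \<comment> \<open>The starting tuple has positive volume, hence so has the maximal one, and its
    columns are linearly independent.\<close>
  then have "0 < vol d" using max[OF d0(1)] by simp
  define M where "M = choose_columns k d V"
  have M: "M \<in> carrier_mat k k" by (simp add: M_def choose_columns_def)
  have detM: "det M \<noteq> 0" using \<open>0 < vol d\<close> by (auto simp: vol_def M_def)
  have inj: "inj_on d {..<k}"
  proof (rule inj_onI, rule ccontr)
    fix a b assume ab: "a \<in> {..<k}" "b \<in> {..<k}" "d a = d b" "a \<noteq> b"
    then have "col M a = col M b" by (intro eq_vecI) (auto simp: M_def choose_columns_def)
    then show False using det_identical_columns[OF M ab(4)] ab detM by simp
  qed
  define b where "b j = vec k (\<lambda>i. V $$ (i, j))" for j
  have "\<forall>j. \<exists>x \<in> carrier_vec k. M *\<^sub>v x = b j"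
    using nonsingular_solve[OF M detM] by (simp add: b_def)
  then obtain x where x: "\<And>j. x j \<in> carrier_vec k" "\<And>j. M *\<^sub>v x j = b j" by metis
  show thesis
  proof
    show "d \<in> ?D" "inj_on d {..<k}" by fact+
    have "V $$ (i, j) = (\<Sum>l<k. V $$ (i, d l) * x j $ l)" if "i < k" "j < m" for i j
    proof -
      have "V $$ (i, j) = (M *\<^sub>v x j) $ i" using x(2) that by (simp add: b_def)
      also have "\<dots> = (\<Sum>l<k. V $$ (i, d l) * x j $ l)"
        using that M x(1)[of j] by (auto simp: scalar_prod_def lessThan_atLeast0 M_def choose_columns_def intro!: sum.cong)
      finally show ?thesis .
    qed
    then show "\<forall>i<k. \<forall>j<m. V $$ (i, j) = (\<Sum>l<k. V $$ (i, d l) * x j $ l)" by blast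
    have "\<bar>x j $ l\<bar> * w (d l) \<le> w j" if "l < k" "j < m" for l j
    proof -
      \<comment> \<open>Exchanging the \<open>l\<close>-th chosen column for column \<open>j\<close>
        replaces column \<open>l\<close> of \<open>M\<close> by \<open>M *\<^sub>v x j\<close>,
        which by Cramer's rule multiplies the determinant by \<open>x j $ l\<close>. Tuples with
        repeated entries belong to \<open>?D\<close>, so the new tuple is always a legal
        competitor.\<close>
      let ?d = "d(l := j)"
      have d': "?d \<in> ?D" using d(1) that by (auto simp: PiE_def extensional_def)
      have "choose_columns k ?d V = replace_col M (M *\<^sub>v x j) l"
        unfolding x(2) using that by (auto simp: choose_columns_def replace_col_def M_def b_def intro!: eq_matI)
      then have D: "\<bar>det (choose_columns k ?d V)\<bar> = \<bar>x j $ l\<bar> * \<bar>det M\<bar>"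
        using cramer_lemma_mat[OF M x(1) that(1)] by (simp add: abs_mult)
      \<comment> \<open>The weight products of the two tuples differ only in the factor at
        \<open>l\<close>; after cancelling the rest, maximality is the bound on the
        coefficient.\<close>
      let ?P = "\<Prod>i\<in>{..<k} - {l}. w (d i)"
      have P: "(\<Prod>i<k. w (d i)) = w (d l) * ?P" "(\<Prod>i<k. w (?d i)) = w j * ?P"
        using that by (auto simp: prod.remove[of _ l] intro!: prod.cong)
      have "d l < m" using d(1) that by auto
      then have wpos: "0 < w (d l)" "0 < w j" using w that by auto
      have "0 < ?P" using d(1) w by (intro prod_pos) auto
      have le: "\<bar>x j $ l\<bar> * \<bar>det M\<bar> / (w j * ?P) \<le> \<bar>det M\<bar> / (w (d l) * ?P)"
        using max[OF d'] unfolding vol_def D P M_def[symmetric] .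
      have key: "a * w (d l) \<le> w j"
        if "a * D / (w j * P) \<le> D / (w (d l) * P)" "0 < P" "0 < D" for a D P :: real
        using that wpos by (simp add: field_simps)
      show ?thesis by (rule key[OF le \<open>0 < ?P\<close>]) (use detM in simp)
    qed
    then show "\<forall>l<k. \<forall>j<m. \<bar>x j $ l\<bar> * w (d l) \<le> w j" by blast
  qed
qed

section \<open>Column submatrices and columnwise norms\<close>

lemma columns_carrier:
  assumes "A \<in> carrier_mat n m" "I \<subseteq> {..<m}"
  shows "columns A I \<in> carrier_mat n (card I)"
proof -
  have "{j. j < m \<and> j \<in> I} = I" using assms(2) by auto
  then show ?thesis using assms(1) by (intro carrier_matI) (simp_all add: columns_def dim_submatrix)
qed

lemma columns_index:
  assumes "A \<in> carrier_mat n m" "I \<subseteq> {..<m}" "i < n" "a < card I"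
  shows "columns A I $$ (i, a) = A $$ (i, pick I a)"
proof -
  have "{j. j < m \<and> j \<in> I} = I" using assms(2) by auto
  then show ?thesis using assms by (simp add: columns_def submatrix_index pick_UNIV)
qed

text \<open>\<open>columns\<close> orders its columns by \<open>pick\<close>; this bijection turns
  sums over positions into sums over column indices, where the order no longer matters.\<close>

lemma bij_betw_pick:
  assumes "finite I"
  shows "bij_betw (pick I) {..<card I} I"
proof -
  have "inj_on (pick I) {..<card I}"
    by (rule linorder_inj_onI') (auto simp: less_imp_neq pick_mono_le)
  moreover have "pick I ` {..<card I} \<subseteq> I" by (auto simp: pick_in_set_le)
  ultimately have "pick I ` {..<card I} = I" using assms
    by (intro card_subset_eq) (auto simp: card_image)
  then show ?thesis using \<open>inj_on (pick I) {..<card I}\<close> by (simp add: bij_betw_def)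
qed

lemma mat_norm_columnwise:
  assumes "1 \<le> p" "0 < n" "0 < m" "M \<in> carrier_mat n m"
  shows "mat_norm p M = lp_norm p {..<m} (\<lambda>j. lp_norm p {..<n} (\<lambda>i. M $$ (i, j)))"
  using assms lp_norm_Times[OF assms(1), of "{..<n}" "{..<m}" "\<lambda>ij. M $$ ij"]
  by (auto simp: mat_norm_def lessThan_empty_iff)

lemma columns_mult_index:
  assumes "A \<in> carrier_mat n m" "I \<subseteq> {..<m}" "W \<in> carrier_mat (card I) m" "i < n" "j < m"
  shows "(columns A I * W) $$ (i, j) = (\<Sum>a<card I. A $$ (i, pick I a) * W $$ (a, j))"
  using assms columns_carrier[OF assms(1,2)]
  by (auto simp: scalar_prod_def columns_index lessThan_atLeast0 intro!: sum.cong)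

text \<open>Independence of the first \<open>k\<close> columns of \<open>V\<close> provides the
  starting tuple for the maximization. The summand \<open>eps\<close> keeps the weights positive
  where a column error is 0; it costs \<open>eps\<close> times the norm of the constant function
  1.\<close>

lemma column_selection_nonsingular:
  fixes A U V :: "real mat"
  assumes p: "1 \<le> p" and dims: "0 < k" "k \<le> m" "0 < n"
    and A: "A \<in> carrier_mat n m" and U: "U \<in> carrier_mat n k" and V: "V \<in> carrier_mat k m"
    and det: "det (choose_columns k (\<lambda>l. l) V) \<noteq> 0" and eps: "0 < eps"
  shows "\<exists>I W. I \<subseteq> {..<m} \<and> card I = k \<and> W \<in> carrier_mat k m \<and>
    mat_norm p (A - columns A I * W)
      \<le> (real k + 1) * (mat_norm p (A - U * V) + eps * lp_norm p {..<m} (\<lambda>_. 1))"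
proof -
  define E where "E i j = A $$ (i, j) - (\<Sum>l<k. U $$ (i, l) * V $$ (l, j))" for i j
  have E: "(A - U * V) $$ (i, j) = E i j" if "i < n" "j < m" for i j
    using that A U V by (auto simp: E_def scalar_prod_def lessThan_atLeast0 intro!: sum.cong)
  define e where "e j = lp_norm p {..<n} (\<lambda>i. E i j)" for j
  have e: "0 \<le> e j" for j using dims by (auto simp: e_def lessThan_empty_iff intro!: lp_norm_nonneg)
  define w where "w j = e j + eps" for j
  have w: "0 < w j" "e j \<le> w j" for j using e[of j] eps by (auto simp: w_def)
  \<comment> \<open>The restriction makes the tuple an element of the extensional function space,
    which is finite.\<close>
  let ?d0 = "restrict (\<lambda>l. l) {..<k}"
  have "choose_columns k ?d0 V = choose_columns k (\<lambda>l. l) V"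
    by (auto simp: choose_columns_def intro!: eq_matI)
  then have det0: "det (choose_columns k ?d0 V) \<noteq> 0" using det by simp
  have d0: "?d0 \<in> {..<k} \<rightarrow>\<^sub>E {..<m}" using dims by auto
  obtain d c where d: "d \<in> {..<k} \<rightarrow>\<^sub>E {..<m}" "inj_on d {..<k}"
    and c': "\<forall>i<k. \<forall>j<m. V $$ (i, j) = (\<Sum>l<k. V $$ (i, d l) * c l j)"
      "\<forall>l<k. \<forall>j<m. \<bar>c l j\<bar> * w (d l) \<le> w j"
    by (rule max_volume_columns[of m w ?d0 k V, OF w(1) d0 det0])
  have c: "\<And>i j. i < k \<Longrightarrow> j < m \<Longrightarrow> V $$ (i, j) = (\<Sum>l<k. V $$ (i, d l) * c l j)"
      "\<And>l j. l < k \<Longrightarrow> j < m \<Longrightarrow> \<bar>c l j\<bar> * w (d l) \<le> w j"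
    using c' by auto
  define I where "I = d ` {..<k}"
  have I: "I \<subseteq> {..<m}" "card I = k" "finite I"
    using d by (auto simp: I_def card_image)
  \<comment> \<open>The coefficients are numbered by positions in \<open>d\<close>, the columns of
    \<open>columns A I\<close> by the size of their index; \<open>g\<close> recovers the position
    from the index.\<close>
  define g where "g = inv_into {..<k} d"
  have g: "g (d l) = l" if "l < k" for l using that d(2) by (simp add: g_def)
  define W where "W = mat k m (\<lambda>(a, j). c (g (pick I a)) j)"
  have W: "W \<in> carrier_mat k m" by (simp add: W_def)
  have CW: "columns A I * W \<in> carrier_mat n m" using columns_carrier[OF A I(1)] W I by auto
  \<comment> \<open>Writing column \<open>j\<close> of \<open>V\<close> through the chosen columns
    makes the parts coming from \<open>U * V\<close> cancel, so that only columns of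
    \<open>E\<close> remain.\<close>
  have error: "(A - columns A I * W) $$ (i, j) = E i j + (\<Sum>l<k. - c l j * E i (d l))"
    if ij: "i < n" "j < m" for i j
  proof -
    have "(columns A I * W) $$ (i, j) = (\<Sum>a<k. A $$ (i, pick I a) * c (g (pick I a)) j)"
      using columns_mult_index[OF A I(1) _ ij, of W] W I ij by (auto simp: W_def intro!: sum.cong)
    also have "\<dots> = (\<Sum>x\<in>I. A $$ (i, x) * c (g x) j)"
      using sum.reindex_bij_betw[OF bij_betw_pick[OF I(3)], of "\<lambda>x. A $$ (i, x) * c (g x) j"] I by simp
    also have "\<dots> = (\<Sum>l<k. A $$ (i, d l) * c l j)"
      unfolding I_def using d(2) g by (simp add: sum.reindex)
    finally have *: "(columns A I * W) $$ (i, j) = (\<Sum>l<k. A $$ (i, d l) * c l j)" .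
    have "(\<Sum>r<k. U $$ (i, r) * V $$ (r, j)) = (\<Sum>r<k. \<Sum>l<k. c l j * (U $$ (i, r) * V $$ (r, d l)))"
      using c(1) ij by (auto simp: sum_distrib_left mult_ac intro!: sum.cong)
    also have "\<dots> = (\<Sum>l<k. c l j * (\<Sum>r<k. U $$ (i, r) * V $$ (r, d l)))"
      by (subst sum.swap) (simp add: sum_distrib_left)
    finally have UV: "(\<Sum>r<k. U $$ (i, r) * V $$ (r, j)) = (\<Sum>l<k. c l j * (\<Sum>r<k. U $$ (i, r) * V $$ (r, d l)))" .
    have "(A - columns A I * W) $$ (i, j) = A $$ (i, j) - (\<Sum>l<k. A $$ (i, d l) * c l j)"
      unfolding *[symmetric] by (rule index_minus_mat) (use CW ij in auto)
    also have "\<dots> = E i j + (\<Sum>l<k. - c l j * E i (d l))"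
      unfolding E_def UV by (simp add: algebra_simps sum.distrib sum_negf sum_subtractf)
    finally show ?thesis .
  qed
  have nonempty: "{..<n} \<noteq> {}" "{..<m} \<noteq> {}" using dims by (auto simp: lessThan_empty_iff)
  have col: "lp_norm p {..<n} (\<lambda>i. (A - columns A I * W) $$ (i, j)) \<le> (real k + 1) * w j"
    if j: "j < m" for j
  proof -
    have "lp_norm p {..<n} (\<lambda>i. (A - columns A I * W) $$ (i, j))
        = lp_norm p {..<n} (\<lambda>i. E i j + (\<Sum>l<k. - c l j * E i (d l)))"
      using error j by (intro lp_norm_cong) auto
    also have "\<dots> \<le> e j + (\<Sum>l<k. lp_norm p {..<n} (\<lambda>i. - c l j * E i (d l)))"
      unfolding e_def
      by (intro order_trans[OF lp_norm_triangle] add_left_mono lp_norm_sum p) (use nonempty in auto)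
    also have "\<dots> = e j + (\<Sum>l<k. \<bar>c l j\<bar> * e (d l))"
      by (simp only: lp_norm_scale[OF p finite_lessThan nonempty(1)] e_def abs_minus_cancel)
    \<comment> \<open>Each summand is at most \<open>w j\<close>: first
      \<open>e (d l) \<le> w (d l)\<close>, then the coefficient bound from the maximal volume
      applies.\<close>
    also have "\<dots> \<le> w j + (\<Sum>l<k. w j)"
      using w(2) j by (intro add_mono sum_mono order_trans[OF mult_left_mono c(2)]) auto
    finally show ?thesis by (simp add: algebra_simps)
  qed
  have "mat_norm p (A - columns A I * W)
      = lp_norm p {..<m} (\<lambda>j. lp_norm p {..<n} (\<lambda>i. (A - columns A I * W) $$ (i, j)))"
    using dims minus_carrier_mat[OF CW] by (intro mat_norm_columnwise p) auto
  also have "\<dots> \<le> lp_norm p {..<m} (\<lambda>j. (real k + 1) * w j)"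
  proof (rule lp_norm_mono[OF p _ nonempty(2)])
    fix j assume "j \<in> {..<m}"
    moreover have "0 \<le> lp_norm p {..<n} (\<lambda>i. (A - columns A I * W) $$ (i, j))"
      using nonempty by (intro lp_norm_nonneg) auto
    ultimately show "\<bar>lp_norm p {..<n} (\<lambda>i. (A - columns A I * W) $$ (i, j))\<bar> \<le> \<bar>(real k + 1) * w j\<bar>"
      using col[of j] by (intro order_trans[OF _ abs_ge_self]) simp
  qed simp
  also have "\<dots> = (real k + 1) * lp_norm p {..<m} w"
    using nonempty by (subst lp_norm_scale[OF p]) auto
  also have "\<dots> \<le> (real k + 1) * (lp_norm p {..<m} e + lp_norm p {..<m} (\<lambda>_. eps * 1))"
    unfolding w_def using nonempty lp_norm_triangle[OF p _ nonempty(2), of e "\<lambda>_. eps"]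
    by (intro mult_left_mono) auto
  also have "lp_norm p {..<m} (\<lambda>_. eps * 1) = eps * lp_norm p {..<m} (\<lambda>_. 1)"
    using nonempty eps by (subst lp_norm_scale[OF p]) auto
  also have "lp_norm p {..<m} e = mat_norm p (A - U * V)"
    unfolding e_def using dims A U V E
    by (subst mat_norm_columnwise[OF p, of n m]) (auto intro!: lp_norm_cong arg_cong[where f = abs])
  finally show ?thesis using I W by blast
qed

section \<open>Removing the rank assumption by perturbation\<close>

text \<open>The shifts with vanishing determinant are the negatives of the eigenvalues of
  \<open>M\<close>, and these are the roots of its monic characteristic polynomial.\<close>

lemma finite_singular_shifts:
  fixes M :: "real mat"
  assumes M: "M \<in> carrier_mat k k"
  shows "finite {t. det (M + t \<cdot>\<^sub>m 1\<^sub>m k) = 0}"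
proof -
  have "char_poly M \<noteq> 0" using degree_monic_char_poly[OF M] by auto
  then have "finite {e. poly (char_poly M) e = 0}" by (rule poly_roots_finite)
  then have fin: "finite ((\<lambda>e. - e) ` {e. poly (char_poly M) e = 0})" by simp
  have "{t. det (M + t \<cdot>\<^sub>m 1\<^sub>m k) = 0} \<subseteq> (\<lambda>e. - e) ` {e. poly (char_poly M) e = 0}"
  proof
    fix t assume "t \<in> {t. det (M + t \<cdot>\<^sub>m 1\<^sub>m k) = 0}"
    moreover have "char_matrix M (- t) = M + t \<cdot>\<^sub>m 1\<^sub>m k"
      using M by (simp add: char_matrix_def)
    ultimately have "poly (char_poly M) (- t) = 0"
      using eigenvalue_det[OF M, of "- t"] eigenvalue_root_char_poly[OF M, of "- t"] by simp
    then show "t \<in> (\<lambda>e. - e) ` {e. poly (char_poly M) e = 0}" by (intro image_eqI[of _ _ "- t"]) auto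
  qed
  then show ?thesis using fin finite_subset by blast
qed

lemma mat_norm_nonneg:
  assumes "0 < n" "0 < m" "M \<in> carrier_mat n m"
  shows "0 \<le> mat_norm p M"
  using assms unfolding mat_norm_def by (intro lp_norm_nonneg) (auto simp: lessThan_empty_iff)

text \<open>Adding \<open>t\<close> times \<open>J\<close> to \<open>V\<close> shifts its leading
  block by \<open>t\<close> times the identity, so all but finitely many \<open>t\<close> make that
  block nonsingular. The error grows by at most \<open>t\<close> times the norm of
  \<open>U * J\<close>, and the same \<open>t\<close> serves as \<open>eps\<close>.\<close>

lemma column_selection:
  fixes A U V :: "real mat"
  assumes p: "1 \<le> p" and dims: "0 < k" "k \<le> m" "0 < n"
    and A: "A \<in> carrier_mat n m" and U: "U \<in> carrier_mat n k" and V: "V \<in> carrier_mat k m"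
    and delta: "0 < delta"
  shows "\<exists>I W. I \<subseteq> {..<m} \<and> card I = k \<and> W \<in> carrier_mat k m \<and>
    mat_norm p (A - columns A I * W) \<le> (real k + 1) * (mat_norm p (A - U * V) + delta)"
proof -
  define J where "J = mat k m (\<lambda>(i, j). if i = j then 1 else 0 :: real)"
  have J: "J \<in> carrier_mat k m" by (simp add: J_def)
  \<comment> \<open>\<open>C\<close> collects both costs per unit of \<open>t\<close>; the bound
    \<open>delta / (C + 1)\<close> on \<open>t\<close> makes sense even for
    \<open>C = 0\<close>.\<close>
  define C where "C = mat_norm p (U * J) + lp_norm p {..<m} (\<lambda>_. 1)"
  have "0 \<le> mat_norm p (U * J)" using dims U J by (intro mat_norm_nonneg[of n m]) auto
  moreover have "0 \<le> lp_norm p {..<m} (\<lambda>_. 1)" using dims by (intro lp_norm_nonneg) (auto simp: lessThan_empty_iff)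
  ultimately have C: "0 \<le> C" by (simp add: C_def)
  define M where "M = choose_columns k (\<lambda>l. l) V"
  have M: "M \<in> carrier_mat k k" by (simp add: M_def choose_columns_def)
  have "infinite {0<..<delta / (C + 1)}" using delta C by (simp add: infinite_Ioo)
  then have "infinite ({0<..<delta / (C + 1)} - {t. det (M + t \<cdot>\<^sub>m 1\<^sub>m k) = 0})"
    using finite_singular_shifts[OF M] by (rule Diff_infinite_finite[rotated])
  then have "{0<..<delta / (C + 1)} - {t. det (M + t \<cdot>\<^sub>m 1\<^sub>m k) = 0} \<noteq> {}"
    by (rule infinite_imp_nonempty)
  then obtain t where "t \<in> {0<..<delta / (C + 1)} - {t. det (M + t \<cdot>\<^sub>m 1\<^sub>m k) = 0}"
    by blast
  then have t: "0 < t" "t < delta / (C + 1)" "det (M + t \<cdot>\<^sub>m 1\<^sub>m k) \<noteq> 0"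
    by simp_all
  define V' where "V' = V + t \<cdot>\<^sub>m J"
  have V': "V' \<in> carrier_mat k m" using V J by (simp add: V'_def)
  have "choose_columns k (\<lambda>l. l) V' = M + t \<cdot>\<^sub>m 1\<^sub>m k"
    using V dims by (auto simp: choose_columns_def M_def V'_def J_def intro!: eq_matI)
  then have "det (choose_columns k (\<lambda>l. l) V') \<noteq> 0" using t(3) by simp
  from column_selection_nonsingular[OF p dims A U V' this t(1)] obtain I W where
    IW: "I \<subseteq> {..<m}" "card I = k" "W \<in> carrier_mat k m"
    "mat_norm p (A - columns A I * W)
      \<le> (real k + 1) * (mat_norm p (A - U * V') + t * lp_norm p {..<m} (\<lambda>_. 1))" by blast
  let ?S = "{..<n} \<times> {..<m}"
  have S: "finite ?S" "?S \<noteq> {}" using dims by (auto simp: lessThan_empty_iff)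
  have "mat_norm p (A - U * V') = lp_norm p ?S (\<lambda>ij. (A - U * V) $$ ij + (- t) * (U * J) $$ ij)"
  proof -
    have "(A - U * V') $$ (i, j) = (A - U * V) $$ (i, j) + (- t) * (U * J) $$ (i, j)"
      if "i < n" "j < m" for i j
    proof -
      have "U * V' = U * V + t \<cdot>\<^sub>m (U * J)"
        unfolding V'_def using U V J by (simp add: mult_add_distrib_mat[of _ n k] mult_smult_distrib)
      then show ?thesis using that A U V J by simp
    qed
    then show ?thesis using A U V' by (auto simp: mat_norm_def intro!: lp_norm_cong arg_cong[where f = abs])
  qed
  also have "\<dots> \<le> lp_norm p ?S (\<lambda>ij. (A - U * V) $$ ij) + lp_norm p ?S (\<lambda>ij. (- t) * (U * J) $$ ij)"
    by (rule lp_norm_triangle[OF p S])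
  also have "\<dots> = mat_norm p (A - U * V) + t * mat_norm p (U * J)"
    using t(1) U V J A by (simp only: lp_norm_scale[OF p S]) (simp add: mat_norm_def)
  finally have "mat_norm p (A - U * V') + t * lp_norm p {..<m} (\<lambda>_. 1) \<le> mat_norm p (A - U * V) + t * C"
    by (simp add: C_def algebra_simps)
  moreover have "t * C \<le> delta"
  proof -
    have "t * C \<le> t * (C + 1)" using t(1) by simp
    also have "\<dots> \<le> delta" using t(2) C by (simp add: field_simps)
    finally show ?thesis .
  qed
  ultimately have le: "(real k + 1) * (mat_norm p (A - U * V') + t * lp_norm p {..<m} (\<lambda>_. 1))
    \<le> (real k + 1) * (mat_norm p (A - U * V) + delta)"
    by (intro mult_left_mono) auto
  show ?thesis
    by (rule exI[of _ I], rule exI[of _ W]) (intro conjI IW(1-3) order_trans[OF IW(4) le])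
qed

text \<open>The column set supplied by \<open>column_selection\<close> may change with
  \<open>delta\<close>, but the output is at least as good as every column set with every
  coefficient matrix. So \<open>delta\<close> can tend to 0 while the output stays fixed, and the
  bound passes to the infimum over all \<open>U'\<close> and \<open>V'\<close>.\<close>

lemma enumeration_output_bound:
  assumes p: "1 \<le> p" and dims: "0 < k" "k \<le> m" "0 < n" and A: "A \<in> carrier_mat n m"
    and out: "enumeration_output k p A U V"
  shows "mat_norm p (A - U * V) \<le> (real k + 1) * opt k p A"
proof -
  have dimA: "dim_row A = n" "dim_col A = m" using A by auto
  obtain F J where F: "\<And>I. I \<subseteq> {..<m} \<and> card I = k \<Longrightarrow>
       is_arg_min (\<lambda>W. mat_norm p (A - columns A I * W)) (\<lambda>W. W \<in> carrier_mat k m) (F I)"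
    and J: "is_arg_min (\<lambda>I. mat_norm p (A - columns A I * F I)) (\<lambda>I. I \<subseteq> {..<m} \<and> card I = k) J"
    and UV: "U = columns A J" "V = F J"
    using out unfolding enumeration_output_def dimA by blast
  define K where "K = real k + 1"
  have K: "0 < K" by (simp add: K_def)
  have bound: "mat_norm p (A - U * V) / K \<le> mat_norm p (A - U' * V')"
    if U': "U' \<in> carrier_mat n k" and V': "V' \<in> carrier_mat k m" for U' V'
  proof (rule field_le_epsilon)
    fix delta :: real assume "0 < delta"
    from column_selection[OF p dims A U' V' this] obtain I W where
      IW: "I \<subseteq> {..<m}" "card I = k" "W \<in> carrier_mat k m"
      "mat_norm p (A - columns A I * W) \<le> K * (mat_norm p (A - U' * V') + delta)"
      unfolding K_def by blast
    have "mat_norm p (A - U * V) \<le> mat_norm p (A - columns A I * F I)"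
      using J IW(1,2) unfolding is_arg_min_linorder UV by auto
    also have "\<dots> \<le> mat_norm p (A - columns A I * W)"
      using F[of I] IW unfolding is_arg_min_linorder by auto
    also note IW(4)
    finally show "mat_norm p (A - U * V) / K \<le> mat_norm p (A - U' * V') + delta"
      using K by (simp add: field_simps)
  qed
  have "mat_norm p (A - U * V) / K \<le> opt k p A"
    unfolding opt_def dimA
  proof (rule cInf_greatest)
    have "0\<^sub>m n k \<in> carrier_mat n k" "0\<^sub>m k m \<in> carrier_mat k m" by auto
    then show "{mat_norm p (A - U * V) |U V. U \<in> carrier_mat n k \<and> V \<in> carrier_mat k m} \<noteq> {}"
      by blast
  qed (use bound in auto)
  then show ?thesis using K by (simp add: field_simps K_def)
qed

section \<open>Effect and cost of programs\<close>

text \<open>The final store does not depend on the running times of the solver, so they may be taken to be 0.\<close>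

definition run :: "(real mat \<Rightarrow> real vec \<Rightarrow> real vec) \<Rightarrow> com \<Rightarrow> store \<Rightarrow> store" where
  "run reg c s = fst (exec reg (\<lambda>_ _. 0) c s)"

text \<open>Running times are only accumulated and never read, so dropping them from the loop state
  leaves a fold over stores.\<close>

lemma fst_fold_exec:
  assumes "\<And>s. fst (exec reg reg_time c s) = f s"
  shows "fst (fold (\<lambda>i (s', t). let (s1, t1) = exec reg reg_time c (nset x 0 i s') in (s1, t + 1 + t1))
      xs (s, t)) = fold (\<lambda>i s. f (nset x 0 i s)) xs s"
  by (induction xs arbitrary: s t) (auto simp: split_beta Let_def assms)

lemma fst_exec: "fst (exec reg reg_time c s) = run reg c s"
  unfolding run_def
proof (induction c arbitrary: s)
  case (For x e c)
  show ?case using fst_fold_exec[OF For] fst_fold_exec[OF refl, of reg "\<lambda>_ _. 0" c x] by simp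
qed (auto simp: split_beta Let_def)

lemma run_simps [simp]:
  "run reg Skip s = s"
  "run reg (NSet x e f) s = nset x (nval e s) (nval f s) s"
  "run reg (RSet X e f r) s = rset X (nval e s) (nval f s) (rval r s) s"
  "run reg (c ;; d) s = run reg d (run reg c s)"
  "run reg (Cond b c d) s = (if bval b s then run reg c s else run reg d s)"
  "run reg (Regress Y M B en ek ec) s =
     set_col Y (nval ek s) (nval ec s)
       (reg (block s M (nval en s) (nval ek s)) (col_block s B (nval en s) (nval ec s))) s"
  by (auto simp: run_def split_beta Let_def)

lemma run_For: "run reg (For x e c) s = fold (\<lambda>i s. run reg c (nset x 0 i s)) [0..<nval e s] s"
  unfolding run_def using fst_fold_exec[OF refl] by simp

text \<open>The invariant is indexed by the number of completed rounds. The total number of rounds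
  is read off from the initial store, since the bound is evaluated on entry.\<close>

lemma run_For_induct:
  assumes "I 0 s" "\<And>i t. i < nval e s \<Longrightarrow> I i t \<Longrightarrow> I (Suc i) (run reg c (nset x 0 i t))"
  shows "I (nval e s) (run reg (For x e c) s)"
proof -
  have "I a (fold (\<lambda>i s. run reg c (nset x 0 i s)) [0..<a] s)" if "a \<le> nval e s" for a
    using that by (induction a) (auto simp: assms)
  then show ?thesis by (simp add: run_For)
qed

section \<open>Basic updates and frame conditions\<close>

lemma store_simps [simp]:
  "nats (nset x i a s) = (nats s)(x := (nats s x)(i := a))"
  "reals (nset x i a s) = reals s"
  "nats (rset X i j b s) = nats s"
  "reals (rset X i j b s) = (reals s)(X := (reals s X)(i := (reals s X i)(j := b)))"
  "nats (set_col X k c y s) = nats s"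
  "reals (set_col X k c y s) =
     (reals s)(X := (\<lambda>i j. if i < k \<and> j = c then y $ i else reals s X i j))"
  by (simp_all add: nset_def rset_def set_col_def)

text \<open>Only names of arrays are recorded, not cells, so that frame conditions can be read off
  from the program text by simplification.\<close>

primrec nwrites :: "com \<Rightarrow> string set" where
  "nwrites Skip = {}"
| "nwrites (NSet x e f) = {x}"
| "nwrites (RSet X e f r) = {}"
| "nwrites (c ;; d) = nwrites c \<union> nwrites d"
| "nwrites (Cond b c d) = nwrites c \<union> nwrites d"
| "nwrites (For x e c) = insert x (nwrites c)"
| "nwrites (Regress Y M B en ek ec) = {}"

primrec rwrites :: "com \<Rightarrow> string set" where
  "rwrites Skip = {}"
| "rwrites (NSet x e f) = {}"
| "rwrites (RSet X e f r) = {X}"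
| "rwrites (c ;; d) = rwrites c \<union> rwrites d"
| "rwrites (Cond b c d) = rwrites c \<union> rwrites d"
| "rwrites (For x e c) = rwrites c"
| "rwrites (Regress Y M B en ek ec) = {Y}"

lemma nats_run: "x \<notin> nwrites c \<Longrightarrow> nats (run reg c s) x = nats s x"
proof (induction c arbitrary: s)
  case (For y e c)
  then show ?case by (intro run_For_induct[where I = "\<lambda>_ t. nats t x = nats s x"]) auto
qed auto

lemma reals_run: "X \<notin> rwrites c \<Longrightarrow> reals (run reg c s) X = reals s X"
proof (induction c arbitrary: s)
  case (For y e c)
  then show ?case by (intro run_For_induct[where I = "\<lambda>_ t. reals t X = reals s X"]) auto
qed auto

section \<open>Cost bounds in terms of the sizes\<close>

definition sizes :: "nat \<Rightarrow> nat \<Rightarrow> nat \<Rightarrow> store \<Rightarrow> bool" where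
  "sizes n m k s \<longleftrightarrow> nats s ''n'' 0 = n \<and> nats s ''m'' 0 = m \<and> nats s ''k'' 0 = k"

definition size_vars :: "string set" where
  "size_vars = {''n'', ''m'', ''k''}"

lemma sizes_run: "sizes n m k s \<Longrightarrow> nwrites c \<inter> size_vars = {} \<Longrightarrow> sizes n m k (run reg c s)"
  using nats_run[of _ c reg s] by (auto simp: sizes_def size_vars_def)

text \<open>In these programs every loop makes at most as many rounds as the largest size, provided
  the sizes are not overwritten. The outer loop with bound \<open>''count''\<close> is not of this
  kind and is counted separately.\<close>

primrec size_bounded :: "com \<Rightarrow> bool" where
  "size_bounded Skip \<longleftrightarrow> True"
| "size_bounded (NSet x e f) \<longleftrightarrow> True"
| "size_bounded (RSet X e f r) \<longleftrightarrow> True"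
| "size_bounded (c ;; d) \<longleftrightarrow> size_bounded c \<and> size_bounded d"
| "size_bounded (Cond b c d) \<longleftrightarrow> size_bounded c \<and> size_bounded d"
| "size_bounded (For x e c) \<longleftrightarrow>
     (\<exists>y \<in> size_vars. e = nvar y \<or> e = NMinus (nvar y) N1) \<and> size_bounded c"
| "size_bounded (Regress Y M B en ek ec) \<longleftrightarrow> en = nvar ''n'' \<and> ek = nvar ''k''"

text \<open>\<open>N\<close> bounds the number of rounds of every loop and \<open>R\<close> the cost of a regression call.\<close>

primrec cost_bound :: "nat \<Rightarrow> nat \<Rightarrow> com \<Rightarrow> nat" where
  "cost_bound N R Skip = 1"
| "cost_bound N R (NSet x e f) = 1 + ncost e + ncost f"
| "cost_bound N R (RSet X e f r) = 1 + ncost e + ncost f + rcost r"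
| "cost_bound N R (c ;; d) = cost_bound N R c + cost_bound N R d"
| "cost_bound N R (Cond b c d) = 1 + bcost b + cost_bound N R c + cost_bound N R d"
| "cost_bound N R (For x e c) = 1 + ncost e + N * (1 + cost_bound N R c)"
| "cost_bound N R (Regress Y M B en ek ec) = 1 + ncost en + ncost ek + ncost ec + R"

text \<open>The bound \<open>B\<close> on the body is only available in stores satisfying
  \<open>I\<close>, so the induction carries the invariant of the current store along with the
  elapsed time. The extra unit per round is the loop overhead.\<close>

lemma snd_exec_For_le:
  assumes "I s"
    and "\<And>i t. i < nval e s \<Longrightarrow> I t \<Longrightarrow> I (run reg c (nset x 0 i t))"
    and "\<And>i t. i < nval e s \<Longrightarrow> I t \<Longrightarrow> snd (exec reg reg_time c (nset x 0 i t)) \<le> B"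
  shows "snd (exec reg reg_time (For x e c) s) \<le> 1 + ncost e + nval e s * (1 + B)"
proof -
  define step where
    "step = (\<lambda>i (s', t). let (s1, t1) = exec reg reg_time c (nset x 0 i s') in (s1, t + 1 + t1))"
  have "I (fst (fold step [0..<a] (s, T))) \<and> snd (fold step [0..<a] (s, T)) \<le> T + a * (1 + B)"
    if "a \<le> nval e s" for a T
    using that
  proof (induction a)
    case 0
    then show ?case using assms(1) by simp
  next
    case (Suc a)
    obtain u t where ut: "fold step [0..<a] (s, T) = (u, t)" by fastforce
    then have "I u" "t \<le> T + a * (1 + B)" using Suc by auto
    moreover have "I (run reg c (nset x 0 a u))" "snd (exec reg reg_time c (nset x 0 a u)) \<le> B"
      using assms(2,3)[OF _ \<open>I u\<close>] Suc.prems by auto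
    moreover have "fold step [0..<Suc a] (s, T) =
        (run reg c (nset x 0 a u), t + 1 + snd (exec reg reg_time c (nset x 0 a u)))"
      using ut by (simp add: step_def split_beta Let_def fst_exec)
    ultimately show ?case by simp
  qed
  from this[of "nval e s" "1 + ncost e"] show ?thesis by (simp add: step_def)
qed

text \<open>Because the size variables are never written, every part of the program starts with the
  same sizes. Hence all loop bounds stay at most \<open>N\<close>, and every regression call has the
  dimensions for which \<open>R\<close> is a bound.\<close>

lemma snd_exec_le:
  assumes "n \<le> N" "m \<le> N" "k \<le> N"
    and "\<And>U v. U \<in> carrier_mat n k \<Longrightarrow> v \<in> carrier_vec n \<Longrightarrow> reg_time U v \<le> R"
  shows "size_bounded c \<Longrightarrow> nwrites c \<inter> size_vars = {} \<Longrightarrow> sizes n m k s \<Longrightarrow>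
    snd (exec reg reg_time c s) \<le> cost_bound N R c"
proof (induction c arbitrary: s)
  case (Seq c d)
  have "sizes n m k (run reg c s)" using Seq.prems by (intro sizes_run) auto
  moreover have "nwrites c \<inter> size_vars = {}" "nwrites d \<inter> size_vars = {}" using Seq.prems by auto
  ultimately have "snd (exec reg reg_time c s) + snd (exec reg reg_time d (run reg c s))
      \<le> cost_bound N R c + cost_bound N R d"
    using Seq by (intro add_mono) auto
  then show ?case by (simp add: split_beta Let_def fst_exec)
next
  case (Cond b c d)
  have "nwrites c \<inter> size_vars = {}" "nwrites d \<inter> size_vars = {}" using Cond.prems by auto
  then have "snd (exec reg reg_time c s) \<le> cost_bound N R c" "snd (exec reg reg_time d s) \<le> cost_bound N R d"
    using Cond by auto
  then show ?case by (simp add: split_beta Let_def)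
next
  case (For x e c)
  have c: "nwrites c \<inter> size_vars = {}" "x \<notin> size_vars" "size_bounded c" using For.prems by auto
  have x: "sizes n m k (nset x 0 i t)" if "sizes n m k t" for i t
    using that c(2) by (auto simp: sizes_def size_vars_def)
  have "nval e s \<le> N"
    using For.prems assms(1-3) by (auto simp: sizes_def size_vars_def)
  have "snd (exec reg reg_time (For x e c) s) \<le> 1 + ncost e + nval e s * (1 + cost_bound N R c)"
    using For.prems(3) For.IH[OF c(3,1)] x
    by (intro snd_exec_For_le[where I = "sizes n m k"] sizes_run c) auto
  also have "\<dots> \<le> 1 + ncost e + N * (1 + cost_bound N R c)"
    using \<open>nval e s \<le> N\<close> by (intro add_left_mono mult_right_mono) auto
  finally show ?case by simp
next
  case (Regress Y M B en ek ec)
  have "reg_time (block s M n k) (col_block s B n (nval ec s)) \<le> R"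
    by (rule assms(4)) (auto simp: block_def col_block_def)
  then show ?case using Regress by (auto simp: Let_def sizes_def)
qed auto

text \<open>The program is fixed, so only the nesting of loops matters: each loop multiplies by
  \<open>N\<close>, which is the polynomial \<open>[:0, 1:]\<close>. The polynomial \<open>r\<close>
  stands for the cost of a regression call.\<close>

lemma cost_bound_poly: "\<exists>q :: nat poly. \<forall>N. cost_bound N (poly r N) c = poly q N"
proof (induction c)
  case (Seq c d)
  then obtain q1 q2 where "\<forall>N. cost_bound N (poly r N) c = poly q1 N" "\<forall>N. cost_bound N (poly r N) d = poly q2 N"
    by auto
  then show ?case by (intro exI[of _ "q1 + q2"]) simp
next
  case (Cond b c d)
  then obtain q1 q2 where "\<forall>N. cost_bound N (poly r N) c = poly q1 N" "\<forall>N. cost_bound N (poly r N) d = poly q2 N"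
    by auto
  then show ?case by (intro exI[of _ "[:1 + bcost b:] + q1 + q2"]) simp
next
  case (For x e c)
  then obtain q where "\<forall>N. cost_bound N (poly r N) c = poly q N" by auto
  then show ?case by (intro exI[of _ "[:1 + ncost e:] + [:0, 1:] * (1 + q)"]) simp
next
  case (Regress Y M B en ek ec)
  show ?case by (intro exI[of _ "[:1 + ncost en + ncost ek + ncost ec:] + r"]) simp
next
  case Skip
  show ?case by (intro exI[of _ 1]) simp
next
  case (NSet x e f)
  show ?case by (intro exI[of _ "[:1 + ncost e + ncost f:]"]) simp
next
  case (RSet X e f r)
  show ?case by (intro exI[of _ "[:1 + ncost e + ncost f + rcost r:]"]) simp
qed

lemma poly_nat_mono: "x \<le> y \<Longrightarrow> poly (q :: nat poly) x \<le> poly q y"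
  by (induction q) (auto intro: mult_mono)

section \<open>The parts of the enumeration program\<close>

text \<open>The common pattern of the loops that fill a matrix. The value written may depend on the
  counters and on whatever \<open>agree\<close> preserves, but not on \<open>Y\<close>, so the order
  of filling is irrelevant.\<close>

lemma reals_run_double_For:
  fixes e f r Y h s b
  defines "agree \<equiv> \<lambda>t. (\<forall>x. x \<noteq> ''i'' \<and> x \<noteq> ''j'' \<longrightarrow> nats t x = nats s x) \<and>
    (\<forall>X. X \<noteq> Y \<longrightarrow> reals t X = reals s X)"
  assumes f: "\<And>t. agree t \<Longrightarrow> nval f t = b"
    and r: "\<And>t. agree t \<Longrightarrow> rval r t = h (nats t ''i'' 0) (nats t ''j'' 0)"
  shows "reals (run reg (For ''i'' e (For ''j'' f (RSet Y (nvar ''i'') (nvar ''j'') r))) s) Y i j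
    = (if i < nval e s \<and> j < b then h i j else reals s Y i j)"
proof -
  \<comment> \<open>\<open>Q a c\<close> describes the moment when the rows before \<open>a\<close>
    and the first \<open>c\<close> entries of row \<open>a\<close> have been written.\<close>
  define Q where "Q a c t \<longleftrightarrow> agree t \<and> (\<forall>i j. reals t Y i j =
    (if (i < a \<and> j < b) \<or> (i = a \<and> j < c) then h i j else reals s Y i j))" for a c :: nat and t :: store
  have inner: "Q a b (run reg (For ''j'' f (RSet Y (nvar ''i'') (nvar ''j'') r)) t)"
    if "Q a 0 t" "nats t ''i'' 0 = a" for a :: nat and t :: store
  proof -
    have "nval f t = b" using that f by (simp add: Q_def)
    moreover have "Q a (nval f t) (run reg (For ''j'' f (RSet Y (nvar ''i'') (nvar ''j'') r)) t) \<and>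
        nats (run reg (For ''j'' f (RSet Y (nvar ''i'') (nvar ''j'') r)) t) ''i'' 0 = a"
    proof (rule run_For_induct[where I = "\<lambda>c u. Q a c u \<and> nats u ''i'' 0 = a"])
      fix c u assume u: "Q a c u \<and> nats u ''i'' 0 = a"
      then have ag: "agree (nset ''j'' 0 c u)" by (auto simp: Q_def agree_def)
      from r[OF this] have "rval r (nset ''j'' 0 c u) = h a c" using u by simp
      then show "Q a (Suc c) (run reg (RSet Y (nvar ''i'') (nvar ''j'') r) (nset ''j'' 0 c u)) \<and>
          nats (run reg (RSet Y (nvar ''i'') (nvar ''j'') r) (nset ''j'' 0 c u)) ''i'' 0 = a"
        using u ag by (auto simp: Q_def agree_def less_Suc_eq)
    qed (use that in simp)
    ultimately show ?thesis by simp
  qed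
  have "Q (nval e s) 0 (run reg (For ''i'' e (For ''j'' f (RSet Y (nvar ''i'') (nvar ''j'') r))) s)"
  proof (rule run_For_induct[where I = "\<lambda>a t. Q a 0 t"])
    show "Q 0 0 s" by (simp add: Q_def agree_def)
    fix a t assume "Q a 0 t"
    then have "Q a 0 (nset ''i'' 0 a t)" by (auto simp: Q_def agree_def)
    from inner[OF this] have "Q a b (run reg (For ''j'' f (RSet Y (nvar ''i'') (nvar ''j'') r)) (nset ''i'' 0 a t))"
      by simp
    then show "Q (Suc a) 0 (run reg (For ''j'' f (RSet Y (nvar ''i'') (nvar ''j'') r)) (nset ''i'' 0 a t))"
      by (auto simp: Q_def less_Suc_eq)
  qed
  then show ?thesis by (simp add: Q_def)
qed

lemma run_copy_array:
  assumes "X \<noteq> Y" "x \<noteq> ''i''" "x \<noteq> ''j''"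
  shows "reals (run reg (copy_array Y X e (nvar x)) s) Y i j
    = (if i < nval e s \<and> j < nats s x 0 then reals s X i j else reals s Y i j)"
  unfolding copy_array_def using assms by (intro reals_run_double_For) auto

lemma run_select_columns:
  assumes "sizes n m k s" "i < n" "j < k"
  shows "reals (run reg select_columns s) ''U'' i j = reals s ''A'' i (nats s ''D'' j)"
proof -
  have "reals (run reg select_columns s) ''U'' i j
    = (if i < nval (nvar ''n'') s \<and> j < nats s ''k'' 0 then reals s ''A'' i (nats s ''D'' j) else reals s ''U'' i j)"
    unfolding select_columns_def by (intro reals_run_double_For) auto
  then show ?thesis using assms by (simp add: sizes_def)
qed

lemma run_regress_columns:
  assumes s: "sizes n m k s" and ij: "i < k" "c < m"
  shows "reals (run reg regress_columns s) ''V'' i c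
    = reg (block s ''U'' n k) (col_block s ''A'' n c) $ i"
proof -
  define I where "I a t \<longleftrightarrow> sizes n m k t \<and> reals t ''U'' = reals s ''U'' \<and> reals t ''A'' = reals s ''A'' \<and>
    (\<forall>i<k. \<forall>c<a. reals t ''V'' i c = reg (block s ''U'' n k) (col_block s ''A'' n c) $ i)" for a :: nat and t :: store
  have "I (nval (nvar ''m'') s) (run reg regress_columns s)"
    unfolding regress_columns_def
  proof (rule run_For_induct[where I = I])
    show "I 0 s" using s by (simp add: I_def)
    fix a t assume t: "I a t"
    let ?t = "nset ''c'' 0 a t"
    have "sizes n m k ?t" "block ?t ''U'' n k = block s ''U'' n k" "col_block ?t ''A'' n a = col_block s ''A'' n a"
      using t by (auto simp: I_def sizes_def block_def col_block_def)
    then show "I (Suc a) (run reg (Regress ''V'' ''U'' ''A'' (nvar ''n'') (nvar ''k'') (nvar ''c'')) ?t)"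
      using t by (auto simp: I_def sizes_def less_Suc_eq)
  qed
  then show ?thesis using s ij by (auto simp: I_def sizes_def)
qed

text \<open>The 0 under the maximum is the initial value of \<open>''d''\<close> in the program.\<close>

definition accumulated :: "ereal \<Rightarrow> 'i set \<Rightarrow> ('i \<Rightarrow> real) \<Rightarrow> real" where
  "accumulated p S f = (if p = \<infinity> then Max (insert 0 ((\<lambda>i. \<bar>f i\<bar>) ` S))
     else (\<Sum>i\<in>S. \<bar>f i\<bar> powr real_of_ereal p))"

lemma accumulated_insert:
  assumes "finite S" "x \<notin> S"
  shows "accumulated p (insert x S) f = (if p = \<infinity> then max (accumulated p S f) \<bar>f x\<bar>
     else accumulated p S f + \<bar>f x\<bar> powr real_of_ereal p)"
proof -
  have "Max (insert 0 ((\<lambda>i. \<bar>f i\<bar>) ` insert x S)) = max \<bar>f x\<bar> (Max (insert 0 ((\<lambda>i. \<bar>f i\<bar>) ` S)))"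
    using assms by (simp add: insert_commute[of 0])
  then show ?thesis using assms by (simp add: accumulated_def max.commute)
qed

text \<open>Absolute values are nonnegative and \<open>S\<close> is nonempty, so the additional 0
  does not affect the maximum. In the other case only the final root is missing.\<close>

lemma lp_norm_accumulated:
  assumes "finite S" "S \<noteq> {}"
  shows "lp_norm p S f = (if p = \<infinity> then accumulated p S f
    else accumulated p S f powr (1 / real_of_ereal p))"
  using lp_norm_nonneg[OF assms, of p f] assms by (simp add: accumulated_def lp_norm_def max_def split: if_splits)

lemma run_residual:
  fixes reg s
  defines "r \<equiv> run reg (''r'' :=\<^sub>R RCell ''A'' (nvar ''i'') (nvar ''c'') ;;
        For ''j'' (nvar ''k'')
          (''r'' :=\<^sub>R RMinus (rvar ''r'')
             (RTimes (RCell ''U'' (nvar ''i'') (nvar ''j'')) (RCell ''V'' (nvar ''j'') (nvar ''c''))))) s"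
  assumes "nats s ''k'' 0 = k" "nats s ''i'' 0 = i" "nats s ''c'' 0 = c"
  shows "reals r ''r'' 0 0 = reals s ''A'' i c - (\<Sum>j<k. reals s ''U'' i j * reals s ''V'' j c)"
proof -
  let ?s = "run reg (''r'' :=\<^sub>R RCell ''A'' (nvar ''i'') (nvar ''c'')) s"
  define I where "I a t \<longleftrightarrow> nats t ''i'' 0 = i \<and> nats t ''c'' 0 = c \<and>
    reals t ''U'' = reals s ''U'' \<and> reals t ''V'' = reals s ''V'' \<and>
    reals t ''r'' 0 0 = reals s ''A'' i c - (\<Sum>j<a. reals s ''U'' i j * reals s ''V'' j c)" for a :: nat and t :: store
  have "I (nval (nvar ''k'') ?s) r"
    unfolding r_def run_simps(4)
  proof (rule run_For_induct[where I = I])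
    show "I 0 ?s" using assms by (simp add: I_def)
  qed (auto simp: I_def)
  then show ?thesis using assms by (simp add: I_def)
qed

lemma run_compute_error:
  assumes s: "sizes n m k s" and n: "0 < n" and m: "0 < m"
  shows "reals (run reg (compute_error p) s) ''d'' 0 0 =
    mat_norm p (block s ''A'' n m - block s ''U'' n k * block s ''V'' k m)"
proof -
  define f where "f = (\<lambda>(i, c). reals s ''A'' i c - (\<Sum>j<k. reals s ''U'' i j * reals s ''V'' j c))"
  \<comment> \<open>\<open>P a b\<close> consists of the entries visited so far: the rows before
    \<open>a\<close> and the first \<open>b\<close> entries of row \<open>a\<close>.\<close>
  define P where "P a b = {..<a} \<times> {..<m} \<union> {a} \<times> {..<b}" for a b :: nat
  define Q where "Q a b t \<longleftrightarrow> sizes n m k t \<and> reals t ''A'' = reals s ''A'' \<and> reals t ''U'' = reals s ''U'' \<and>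
    reals t ''V'' = reals s ''V'' \<and> reals t ''d'' 0 0 = accumulated p (P a b) f" for a b :: nat and t :: store
  \<comment> \<open>The program brackets its sequences to the right; grouping the computation of one
    residual separately does not change the final store.\<close>
  define residual where "residual = (''r'' :=\<^sub>R RCell ''A'' (nvar ''i'') (nvar ''c'') ;;
        For ''j'' (nvar ''k'')
          (''r'' :=\<^sub>R RMinus (rvar ''r'')
             (RTimes (RCell ''U'' (nvar ''i'') (nvar ''j'')) (RCell ''V'' (nvar ''j'') (nvar ''c'')))))"
  define update where "update = (if p = \<infinity>
         then Cond (RLess (rvar ''d'') (RAbs (rvar ''r''))) (''d'' :=\<^sub>R RAbs (rvar ''r'')) Skip
         else ''d'' :=\<^sub>R RPlus (rvar ''d'')
                (RPowr (RAbs (rvar ''r'')) (RConst (real_of_ereal p))))"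
  define loop where "loop = For ''i'' (nvar ''n'') (For ''c'' (nvar ''m'')
    (''r'' :=\<^sub>R RCell ''A'' (nvar ''i'') (nvar ''c'') ;;
        For ''j'' (nvar ''k'')
          (''r'' :=\<^sub>R RMinus (rvar ''r'')
             (RTimes (RCell ''U'' (nvar ''i'') (nvar ''j'')) (RCell ''V'' (nvar ''j'') (nvar ''c'')))) ;;
     update))"
  have P: "finite (P a b)" "P a (Suc b) = insert (a, b) (P a b)" "(a, b) \<notin> P a b" "P (Suc a) 0 = P a m" for a b
    by (auto simp: P_def less_Suc_eq)
  have body: "Q a (Suc b) (run reg update (run reg residual t)) \<and> nats (run reg update (run reg residual t)) ''i'' 0 = a"
    if t: "Q a b t" "nats t ''i'' 0 = a" "nats t ''c'' 0 = b" for a b :: nat and t :: store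
  proof -
    define u where "u = run reg residual t"
    have nats_u: "nats u x = nats t x" if "x \<noteq> ''j''" for x
      unfolding u_def by (rule nats_run) (use that in \<open>simp add: residual_def\<close>)
    have reals_u: "reals u X = reals t X" if "X \<noteq> ''r''" for X
      unfolding u_def by (rule reals_run) (use that in \<open>simp add: residual_def\<close>)
    have r: "reals u ''r'' 0 0 = f (a, b)"
      unfolding u_def residual_def f_def using t by (subst run_residual[where k = k and i = a and c = b]) (auto simp: Q_def sizes_def)
    show ?thesis
      unfolding u_def[symmetric] using t r nats_u reals_u
      by (auto simp: Q_def P(2) accumulated_insert[OF P(1,3)] update_def sizes_def max_def)
  qed
  have "Q n 0 (run reg loop (run reg (''d'' :=\<^sub>R RConst 0) s))"
  proof -
    let ?s = "run reg (''d'' :=\<^sub>R RConst 0) s"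
    have "Q (nval (nvar ''n'') ?s) 0 (run reg loop ?s)"
      unfolding loop_def
    proof (rule run_For_induct[where I = "\<lambda>a t. Q a 0 t"])
      show "Q 0 0 ?s" using s by (simp add: Q_def sizes_def P_def accumulated_def)
      fix a t assume t: "Q a 0 t"
      let ?t = "nset ''i'' 0 a t"
      let ?inner = "For ''c'' (nvar ''m'') (''r'' :=\<^sub>R RCell ''A'' (nvar ''i'') (nvar ''c'') ;;
        For ''j'' (nvar ''k'')
          (''r'' :=\<^sub>R RMinus (rvar ''r'')
             (RTimes (RCell ''U'' (nvar ''i'') (nvar ''j'')) (RCell ''V'' (nvar ''j'') (nvar ''c'')))) ;; update)"
      have "Q a (nval (nvar ''m'') ?t) (run reg ?inner ?t) \<and> nats (run reg ?inner ?t) ''i'' 0 = a"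
      proof (rule run_For_induct[where I = "\<lambda>b u. Q a b u \<and> nats u ''i'' 0 = a"])
        show "Q a 0 ?t \<and> nats ?t ''i'' 0 = a" using t by (simp add: Q_def sizes_def)
        fix b u assume u: "Q a b u \<and> nats u ''i'' 0 = a"
        then have "Q a b (nset ''c'' 0 b u)" by (simp add: Q_def sizes_def)
        from body[OF this] u
        show "Q a (Suc b) (run reg (''r'' :=\<^sub>R RCell ''A'' (nvar ''i'') (nvar ''c'') ;;
          For ''j'' (nvar ''k'')
            (''r'' :=\<^sub>R RMinus (rvar ''r'')
             (RTimes (RCell ''U'' (nvar ''i'') (nvar ''j'')) (RCell ''V'' (nvar ''j'') (nvar ''c'')))) ;; update) (nset ''c'' 0 b u)) \<and>
          nats (run reg (''r'' :=\<^sub>R RCell ''A'' (nvar ''i'') (nvar ''c'') ;;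
          For ''j'' (nvar ''k'')
            (''r'' :=\<^sub>R RMinus (rvar ''r'')
             (RTimes (RCell ''U'' (nvar ''i'') (nvar ''j'')) (RCell ''V'' (nvar ''j'') (nvar ''c'')))) ;; update) (nset ''c'' 0 b u)) ''i'' 0 = a"
          by (simp add: residual_def)
      qed
      moreover have "nval (nvar ''m'') ?t = m" using t by (simp add: Q_def sizes_def)
      \<comment> \<open>Having completed row \<open>a\<close> is the same as being about to start
        row \<open>Suc a\<close>.\<close>
      ultimately show "Q (Suc a) 0 (run reg ?inner ?t)" by (simp add: Q_def P(4))
    qed
    then show ?thesis using s by (simp add: sizes_def)
  qed
  then have d: "reals (run reg loop (run reg (''d'' :=\<^sub>R RConst 0) s)) ''d'' 0 0 = accumulated p ({..<n} \<times> {..<m}) f"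
    by (simp add: Q_def P_def)
  have "reals (run reg (compute_error p) s) ''d'' 0 0 = lp_norm p ({..<n} \<times> {..<m}) f"
    unfolding compute_error_def update_def[symmetric] loop_def[symmetric] run_simps(4)
    using d n m by (simp add: lp_norm_accumulated lessThan_empty_iff)
  also have "\<dots> = mat_norm p (block s ''A'' n m - block s ''U'' n k * block s ''V'' k m)"
    unfolding mat_norm_def
    by (auto simp: block_def f_def scalar_prod_def lessThan_atLeast0 intro!: lp_norm_cong arg_cong[where f = abs])
  finally show ?thesis .
qed

lemma run_keep_best:
  fixes reg s
  defines "t \<equiv> run reg keep_best s"
  assumes s: "sizes n m k s"
  shows "nats s ''found'' 0 = 0 \<or> reals s ''d'' 0 0 < reals s ''best'' 0 0 \<Longrightarrow>
      nats t ''found'' 0 = 1 \<and> reals t ''best'' 0 0 = reals s ''d'' 0 0 \<and>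
      block t ''Ubest'' n k = block s ''U'' n k \<and> block t ''Vbest'' k m = block s ''V'' k m"
    and "\<not> (nats s ''found'' 0 = 0 \<or> reals s ''d'' 0 0 < reals s ''best'' 0 0) \<Longrightarrow> t = s"
proof -
  assume c: "nats s ''found'' 0 = 0 \<or> reals s ''d'' 0 0 < reals s ''best'' 0 0"
  define u where "u = run reg (''found'' :=\<^sub>N N1 ;; ''best'' :=\<^sub>R rvar ''d'') s"
  define v where "v = run reg (copy_array ''Ubest'' ''U'' (nvar ''n'') (nvar ''k'')) u"
  have t: "t = run reg (copy_array ''Vbest'' ''V'' (nvar ''k'') (nvar ''m'')) v"
    using c by (simp add: t_def keep_best_def u_def v_def)
  have nv: "nats v x = nats u x" if "x \<noteq> ''i''" "x \<noteq> ''j''" for x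
    unfolding v_def by (rule nats_run) (use that in \<open>simp add: copy_array_def\<close>)
  have rv: "reals v X = reals u X" if "X \<noteq> ''Ubest''" for X
    unfolding v_def by (rule reals_run) (use that in \<open>simp add: copy_array_def\<close>)
  have nt: "nats t x = nats v x" if "x \<noteq> ''i''" "x \<noteq> ''j''" for x
    unfolding t by (rule nats_run) (use that in \<open>simp add: copy_array_def\<close>)
  have rt: "reals t X = reals v X" if "X \<noteq> ''Vbest''" for X
    unfolding t by (rule reals_run) (use that in \<open>simp add: copy_array_def\<close>)
  have U: "reals v ''Ubest'' i j = reals s ''U'' i j" if "i < n" "j < k" for i j
    unfolding v_def using that s by (subst run_copy_array) (auto simp: u_def sizes_def)
  have V: "reals t ''Vbest'' i j = reals s ''V'' i j" if "i < k" "j < m" for i j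
    unfolding t using that s nv rv by (subst run_copy_array) (auto simp: u_def sizes_def)
  show "nats t ''found'' 0 = 1 \<and> reals t ''best'' 0 0 = reals s ''d'' 0 0 \<and>
      block t ''Ubest'' n k = block s ''U'' n k \<and> block t ''Vbest'' k m = block s ''V'' k m"
  proof (intro conjI)
    show "nats t ''found'' 0 = 1" "reals t ''best'' 0 0 = reals s ''d'' 0 0"
      by (simp_all add: nt nv rt rv u_def)
    show "block t ''Ubest'' n k = block s ''U'' n k"
      by (rule eq_matI) (simp_all add: block_def rt U)
    show "block t ''Vbest'' k m = block s ''V'' k m"
      by (rule eq_matI) (simp_all add: block_def V)
  qed
next
  assume "\<not> (nats s ''found'' 0 = 0 \<or> reals s ''d'' 0 0 < reals s ''best'' 0 0)"
  then show "t = s" by (simp add: t_def keep_best_def)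
qed

text \<open>The loop makes \<open>k - 1\<close> rounds, and round \<open>j\<close> compares the
  entries at \<open>j\<close> and \<open>Suc j\<close>; this is the range
  \<open>Suc j < k\<close>.\<close>

lemma run_test_increasing:
  assumes s: "sizes n m k s"
  shows "nats (run reg test_increasing s) ''ok'' 0 = 1 \<longleftrightarrow>
    (\<forall>j. Suc j < k \<longrightarrow> nats s ''D'' j < nats s ''D'' (Suc j))"
proof -
  let ?s = "run reg (''ok'' :=\<^sub>N N1) s"
  define I where "I a t \<longleftrightarrow> nats t ''D'' = nats s ''D'' \<and>
    nats t ''ok'' 0 = (if \<forall>j<a. nats s ''D'' j < nats s ''D'' (Suc j) then 1 else 0)" for a :: nat and t :: store
  have "I (nval (NMinus (nvar ''k'') N1) ?s) (run reg test_increasing s)"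
    unfolding test_increasing_def run_simps(4)
    by (rule run_For_induct[where I = I]) (auto simp: I_def less_Suc_eq)
  then show ?thesis using s by (auto simp: I_def sizes_def less_diff_conv split: if_splits)
qed

text \<open>The machine cannot multiply natural numbers, so each factor \<open>m\<close> is produced
  by adding the current count \<open>m\<close> times.\<close>

lemma run_count_tuples:
  assumes s: "sizes n m k s"
  shows "nats (run reg count_tuples s) ''count'' 0 = m ^ k"
proof -
  let ?s = "run reg (''count'' :=\<^sub>N N1) s"
  define I where "I a t \<longleftrightarrow> sizes n m k t \<and> nats t ''count'' 0 = m ^ a" for a :: nat and t :: store
  have "I (nval (nvar ''k'') ?s) (run reg count_tuples s)"
    unfolding count_tuples_def run_simps(4)
  proof (rule run_For_induct[where I = I])
    show "I 0 ?s" using s by (simp add: I_def sizes_def)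
    fix a t assume t: "I a t"
    let ?t = "run reg (''sum'' :=\<^sub>N N0) (nset ''i'' 0 a t)"
    let ?u = "run reg (For ''j'' (nvar ''m'') (''sum'' :=\<^sub>N NPlus (nvar ''sum'') (nvar ''count''))) ?t"
    define J where "J b u \<longleftrightarrow> sizes n m k u \<and> nats u ''count'' 0 = m ^ a \<and> nats u ''sum'' 0 = b * m ^ a"
      for b :: nat and u :: store
    have "J (nval (nvar ''m'') ?t) ?u"
      by (rule run_For_induct[where I = J]) (use t in \<open>auto simp: I_def J_def sizes_def\<close>)
    moreover have "nval (nvar ''m'') ?t = m" using t by (simp add: I_def sizes_def)
    ultimately have "sizes n m k ?u" "nats ?u ''sum'' 0 = m * m ^ a" by (simp_all add: J_def)
    then have "I (Suc a) (run reg (''count'' :=\<^sub>N nvar ''sum'') ?u)" by (simp add: I_def sizes_def)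
    then show "I (Suc a) (run reg (''sum'' :=\<^sub>N N0 ;;
        For ''j'' (nvar ''m'') (''sum'' :=\<^sub>N NPlus (nvar ''sum'') (nvar ''count'')) ;;
        ''count'' :=\<^sub>N nvar ''sum'') (nset ''i'' 0 a t))"
      by (simp only: run_simps(4))
  qed
  then show ?thesis using s by (simp add: I_def sizes_def)
qed

text \<open>The arithmetic of an odometer: a carry reaches position \<open>a\<close> exactly when
  \<open>m ^ a\<close> divides \<open>Suc x\<close>. Then the digit there is increased, and the
  carry goes on exactly when it wraps around to 0. Without a carry, this digit and all higher ones
  are unchanged.\<close>

lemma Suc_digit:
  fixes m x a :: nat
  assumes m: "0 < m"
  shows "m ^ a dvd Suc x \<Longrightarrow> Suc x div m ^ a mod m =
      (if Suc (x div m ^ a mod m) = m then 0 else Suc (x div m ^ a mod m))"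
    and "m ^ a dvd Suc x \<Longrightarrow> m ^ Suc a dvd Suc x \<longleftrightarrow> Suc (x div m ^ a mod m) = m"
    and "\<not> m ^ a dvd Suc x \<Longrightarrow> Suc x div m ^ a = x div m ^ a"
proof -
  assume dvd: "m ^ a dvd Suc x"
  have q: "Suc x div m ^ a = Suc (x div m ^ a)" using dvd by (simp add: div_Suc dvd_eq_mod_eq_0)
  then show d: "Suc x div m ^ a mod m =
      (if Suc (x div m ^ a mod m) = m then 0 else Suc (x div m ^ a mod m))"
    by (simp add: mod_Suc)
  have "Suc x = m ^ a * Suc (x div m ^ a)" using dvd q by (metis dvd_mult_div_cancel)
  then have "m ^ Suc a dvd Suc x \<longleftrightarrow> m ^ a * m dvd m ^ a * Suc (x div m ^ a)"
    by (simp only: power_Suc2)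
  also have "\<dots> \<longleftrightarrow> m dvd Suc (x div m ^ a)"
    using m by (simp only: nat_mult_dvd_cancel_disj) simp
  also have "\<dots> \<longleftrightarrow> Suc (x div m ^ a) mod m = 0" by (rule dvd_eq_mod_eq_0)
  also have "\<dots> \<longleftrightarrow> Suc (x div m ^ a mod m) = m" by (auto simp: mod_Suc)
  finally show "m ^ Suc a dvd Suc x \<longleftrightarrow> Suc (x div m ^ a mod m) = m" .
next
  assume "\<not> m ^ a dvd Suc x"
  then show "Suc x div m ^ a = x div m ^ a" by (simp add: div_Suc dvd_eq_mod_eq_0)
qed

lemma run_next_tuple:
  assumes s: "sizes n m k s" and m: "0 < m"
    and D: "\<And>j. j < k \<Longrightarrow> nats s ''D'' j = x div m ^ j mod m" and j: "j < k"
  shows "nats (run reg next_tuple s) ''D'' j = Suc x div m ^ j mod m"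
proof -
  let ?s = "run reg (''carry'' :=\<^sub>N N1) s"
  \<comment> \<open>The carry is predicted by divisibility; it starts at 1 because
    \<open>m ^ 0\<close> divides everything. Digits not yet reached still belong to
    \<open>x\<close>.\<close>
  define I where "I a t \<longleftrightarrow> sizes n m k t \<and> nats t ''carry'' 0 = (if m ^ a dvd Suc x then 1 else 0) \<and>
    (\<forall>j<k. nats t ''D'' j = (if j < a then Suc x else x) div m ^ j mod m)" for a :: nat and t :: store
  have "I (nval (nvar ''k'') ?s) (run reg next_tuple s)"
    unfolding next_tuple_def run_simps(4)
  proof (rule run_For_induct[where I = I])
    show "I 0 ?s" using s D by (simp add: I_def sizes_def)
    fix a t assume "a < nval (nvar ''k'') ?s" and t: "I a t"
    then have a: "a < k" using s by (simp add: sizes_def)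
    show "I (Suc a) (run reg (Cond (NEq (nvar ''carry'') N1)
          (NSet ''D'' (nvar ''j'') (NPlus (NCell ''D'' (nvar ''j'')) N1) ;;
           Cond (NEq (NCell ''D'' (nvar ''j'')) (nvar ''m''))
             (NSet ''D'' (nvar ''j'') N0)
             (''carry'' :=\<^sub>N N0))
          Skip) (nset ''j'' 0 a t))"
    proof (cases "m ^ a dvd Suc x")
      case True
      then show ?thesis using t a Suc_digit(1,2)[OF m True]
        by (auto simp: I_def sizes_def less_Suc_eq simp del: power_Suc)
    next
      case False
      \<comment> \<open>Once the carry has stopped it stays 0, since higher powers of
        \<open>m\<close> cannot divide \<open>Suc x\<close> either.\<close>
      then have "\<not> m ^ Suc a dvd Suc x" by (metis dvd_mult_right power_Suc)
      then show ?thesis using t a False Suc_digit(3)[OF m False]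
        by (auto simp: I_def sizes_def less_Suc_eq simp del: power_Suc)
    qed
  qed
  then show ?thesis using s j by (simp add: I_def sizes_def)
qed

section \<open>Correctness of the enumeration\<close>

definition increasing :: "nat \<Rightarrow> (nat \<Rightarrow> nat) \<Rightarrow> bool" where
  "increasing k d \<longleftrightarrow> (\<forall>j. Suc j < k \<longrightarrow> d j < d (Suc j))"

lemma increasing_less:
  assumes "increasing k d" "i < j" "j < k"
  shows "d i < d j"
  using assms(2,3)
proof (induction j)
  case (Suc j)
  then have "d j < d (Suc j)" using assms(1) by (simp add: increasing_def)
  moreover have "i = j \<or> d i < d j" using Suc by (auto simp: less_Suc_eq)
  ultimately show ?case by auto
qed simp

lemma increasing_inj_on: "increasing k d \<Longrightarrow> inj_on d {..<k}"
  by (rule linorder_inj_onI') (auto dest: increasing_less)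

text \<open>Monotonicity leaves exactly \<open>j\<close> entries of the tuple below
  \<open>d j\<close>, so \<open>d j\<close> has rank \<open>j\<close> in the image. Thus reading the
  tuple in order agrees with the order used by \<open>columns\<close>.\<close>

lemma pick_image_increasing:
  assumes "increasing k d" "j < k"
  shows "pick (d ` {..<k}) j = d j"
proof -
  have "{a \<in> d ` {..<k}. a < d j} = d ` {..<j}"
  proof
    show "{a \<in> d ` {..<k}. a < d j} \<subseteq> d ` {..<j}"
    proof
      fix a assume "a \<in> {a \<in> d ` {..<k}. a < d j}"
      then obtain i where i: "i < k" "a = d i" "d i < d j" by auto
      then have "i < j" using increasing_less[OF assms(1), of j i] by (metis linorder_neqE_nat order_less_asym)
      then show "a \<in> d ` {..<j}" using i by simp
    qed
    show "d ` {..<j} \<subseteq> {a \<in> d ` {..<k}. a < d j}"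
      using increasing_less[OF assms(1)] assms(2) by auto
  qed
  moreover have "card (d ` {..<j}) = j"
    using inj_on_subset[OF increasing_inj_on[OF assms(1)], of "{..<j}"] assms(2) by (simp add: card_image)
  ultimately show ?thesis using pick_card_in_set[of "d j" "d ` {..<k}"] assms(2) by simp
qed

lemma increasing_pick: "card I = k \<Longrightarrow> increasing k (pick I)"
  unfolding increasing_def using pick_mono_le[of "Suc j" I j for j] by (metis lessI)

section \<open>Tuples as base-\<open>m\<close> digits\<close>

definition digit :: "nat \<Rightarrow> nat \<Rightarrow> nat \<Rightarrow> nat" where
  "digit m x j = x div m ^ j mod m"

lemma digit_less: "0 < m \<Longrightarrow> digit m x j < m"
  by (simp add: digit_def)

text \<open>Horner's scheme: the entry at 0 is the least significant digit, and the number for the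
  remaining entries is multiplied by \<open>m\<close>.\<close>

lemma ex_digits:
  assumes "\<forall>j<k. d j < m"
  shows "\<exists>x<m ^ k. \<forall>j<k. digit m x j = d j"
  using assms
proof (induction k arbitrary: d)
  case (Suc k)
  then have "\<forall>j<k. d (Suc j) < m" by auto
  from Suc.IH[OF this] obtain x where x: "x < m ^ k" "\<forall>j<k. digit m x j = d (Suc j)"
    by blast
  have d: "d 0 < m" using Suc by simp
  show ?case
  proof (intro exI conjI allI impI)
    have "d 0 + m * x < m + m * x" using d by simp
    also have "\<dots> \<le> m * m ^ k" using x(1) mult_le_mono2[of "Suc x" "m ^ k" m] by simp
    finally show "d 0 + m * x < m ^ Suc k" by simp
    fix j assume "j < Suc k"
    then show "digit m (d 0 + m * x) j = d j"
      using x(2) d by (cases j) (auto simp: digit_def div_mult2_eq)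
  qed
qed simp

section \<open>Columnwise regression on a set of columns\<close>

definition regress_all :: "(real mat \<Rightarrow> real vec \<Rightarrow> real vec) \<Rightarrow> real mat \<Rightarrow> nat set \<Rightarrow> real mat" where
  "regress_all reg A I = mat (card I) (dim_col A) (\<lambda>(a, c). reg (columns A I) (col A c) $ a)"

definition subset_error ::
  "(real mat \<Rightarrow> real vec \<Rightarrow> real vec) \<Rightarrow> ereal \<Rightarrow> real mat \<Rightarrow> nat set \<Rightarrow> real" where
  "subset_error reg p A I = mat_norm p (A - columns A I * regress_all reg A I)"

text \<open>Column \<open>c\<close> of the error depends only on column \<open>c\<close> of
  \<open>W\<close>, and the matrix norm is monotone in the column norms. Minimizing each column
  separately therefore minimizes the whole.\<close>

lemma regress_all_minimizer:
  assumes p: "1 \<le> p" and reg: "regression_solver p reg" and A: "A \<in> carrier_mat n m"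
    and I: "I \<subseteq> {..<m}" "card I = k" and dims: "0 < n" "0 < k" "0 < m"
  shows "is_arg_min (\<lambda>W. mat_norm p (A - columns A I * W)) (\<lambda>W. W \<in> carrier_mat k m)
    (regress_all reg A I)"
proof -
  let ?X = "columns A I"
  let ?R = "regress_all reg A I"
  have X: "?X \<in> carrier_mat n k" using columns_carrier[OF A I(1)] I(2) by simp
  have R: "?R \<in> carrier_mat k m" using A I by (auto simp: regress_all_def)
  have min: "reg ?X (col A c) \<in> carrier_vec k"
    "\<And>y. y \<in> carrier_vec k \<Longrightarrow> vec_norm p (?X *\<^sub>v reg ?X (col A c) - col A c) \<le> vec_norm p (?X *\<^sub>v y - col A c)" for c
  proof -
    have "is_arg_min (\<lambda>y. vec_norm p (?X *\<^sub>v y - col A c)) (\<lambda>y. y \<in> carrier_vec k) (reg ?X (col A c))"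
      using reg dims X col_carrier_vec[of c m A n] A unfolding regression_solver_def
      by (metis carrier_matD(1) carrier_vecI col_dim)
    then show "reg ?X (col A c) \<in> carrier_vec k"
      "\<And>y. y \<in> carrier_vec k \<Longrightarrow> vec_norm p (?X *\<^sub>v reg ?X (col A c) - col A c) \<le> vec_norm p (?X *\<^sub>v y - col A c)"
      by (auto simp: is_arg_min_linorder)
  qed
  have norm: "mat_norm p (A - ?X * W) = lp_norm p {..<m} (\<lambda>c. vec_norm p (?X *\<^sub>v col W c - col A c))"
    if W: "W \<in> carrier_mat k m" for W
  proof -
    have XW: "?X * W \<in> carrier_mat n m" using X W by simp
    have "lp_norm p {..<n} (\<lambda>i. (A - ?X * W) $$ (i, c)) = vec_norm p (?X *\<^sub>v col W c - col A c)"
      if c: "c < m" for c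
    proof -
      have "vec_norm p (?X *\<^sub>v col W c - col A c) = lp_norm p {..<n} (\<lambda>i. (?X *\<^sub>v col W c - col A c) $ i)"
        using A by (simp add: vec_norm_def)
      \<comment> \<open>The regression residual and the error column have opposite signs, which
        absolute values do not see.\<close>
      also have "\<dots> = lp_norm p {..<n} (\<lambda>i. (A - ?X * W) $$ (i, c))"
        using A X W c by (intro lp_norm_cong) (auto simp: abs_minus_commute)
      finally show ?thesis by simp
    qed
    then have "lp_norm p {..<m} (\<lambda>c. lp_norm p {..<n} (\<lambda>i. (A - ?X * W) $$ (i, c)))
        = lp_norm p {..<m} (\<lambda>c. vec_norm p (?X *\<^sub>v col W c - col A c))"
      by (intro lp_norm_cong) simp
    then show ?thesis
      using mat_norm_columnwise[OF p dims(1,3) minus_carrier_mat[OF XW]] by simp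
  qed
  have colR: "col ?R c = reg ?X (col A c)" if "c < m" for c
    using min(1)[of c] that A I(2) by (intro eq_vecI) (auto simp: regress_all_def)
  have nonneg: "0 \<le> vec_norm p (?X *\<^sub>v col W c - col A c)" for W c
    unfolding vec_norm_def using dims A by (intro lp_norm_nonneg) (auto simp: lessThan_empty_iff)
  have "mat_norm p (A - ?X * ?R) \<le> mat_norm p (A - ?X * W)" if W: "W \<in> carrier_mat k m" for W
    unfolding norm[OF R] norm[OF W]
  proof (rule lp_norm_mono[OF p])
    fix c assume "c \<in> {..<m}"
    then show "\<bar>vec_norm p (?X *\<^sub>v col ?R c - col A c)\<bar> \<le> \<bar>vec_norm p (?X *\<^sub>v col W c - col A c)\<bar>"
      using nonneg[of ?R c] nonneg[of W c] min(2)[of "col W c" c] W by (simp add: colR)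
  qed (use dims in \<open>auto simp: lessThan_empty_iff\<close>)
  then show ?thesis using R by (simp add: is_arg_min_linorder)
qed

definition input_array :: "nat \<Rightarrow> nat \<Rightarrow> real mat \<Rightarrow> store \<Rightarrow> bool" where
  "input_array n m A s \<longleftrightarrow> (\<forall>i<n. \<forall>j<m. reals s ''A'' i j = A $$ (i, j))"

lemma input_array_run: "input_array n m A s \<Longrightarrow> ''A'' \<notin> rwrites c \<Longrightarrow> input_array n m A (run reg c s)"
  by (simp add: input_array_def reals_run)

lemma run_subset:
  fixes reg s p k
  defines "t \<equiv> run reg (select_columns ;; regress_columns ;; compute_error p) s"
    and "I \<equiv> nats s ''D'' ` {..<k}"
  assumes s: "sizes n m k s" "input_array n m A s" and A: "A \<in> carrier_mat n m"
    and dims: "0 < n" "0 < m"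
    and D: "increasing k (nats s ''D'')" "\<forall>j<k. nats s ''D'' j < m"
  shows "block t ''U'' n k = columns A I" "block t ''V'' k m = regress_all reg A I"
    "reals t ''d'' 0 0 = subset_error reg p A I"
proof -
  define u where "u = run reg select_columns s"
  define v where "v = run reg regress_columns u"
  have t: "t = run reg (compute_error p) v" by (simp add: t_def u_def v_def)
  have sz: "sizes n m k u" "sizes n m k v"
    unfolding v_def u_def
    by (auto intro!: sizes_run s simp: select_columns_def regress_columns_def size_vars_def)
  have inp: "input_array n m A u" "input_array n m A v"
    unfolding v_def u_def
    by (auto intro!: input_array_run s simp: select_columns_def regress_columns_def)
  have I: "I \<subseteq> {..<m}" "card I = k"
    using D increasing_inj_on[OF D(1)] by (auto simp: I_def card_image)
  have Ublock: "block u ''U'' n k = columns A I"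
  proof (rule eq_matI)
    show "dim_row (block u ''U'' n k) = dim_row (columns A I)" "dim_col (block u ''U'' n k) = dim_col (columns A I)"
      using columns_carrier[OF A I(1)] I(2) by (auto simp: block_def)
    fix i j assume "i < dim_row (columns A I)" "j < dim_col (columns A I)"
    then have ij: "i < n" "j < k" using columns_carrier[OF A I(1)] I(2) by auto
    have "block u ''U'' n k $$ (i, j) = reals s ''A'' i (nats s ''D'' j)"
      unfolding u_def using ij run_select_columns[OF s(1) ij] by (simp add: block_def)
    also have "\<dots> = A $$ (i, nats s ''D'' j)" using s(2) ij D(2) by (simp add: input_array_def)
    \<comment> \<open>Since the tuple is increasing, the program lists the columns in the order of
      \<open>columns\<close>.\<close>
    also have "nats s ''D'' j = pick I j"
      using pick_image_increasing[OF D(1) ij(2)] by (simp add: I_def)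
    also have "A $$ (i, pick I j) = columns A I $$ (i, j)"
      using columns_index[OF A I(1), of i j] ij I(2) by simp
    finally show "block u ''U'' n k $$ (i, j) = columns A I $$ (i, j)" .
  qed
  have cols: "col_block u ''A'' n c = col A c" if "c < m" for c
    using inp(1) A that by (intro eq_vecI) (auto simp: col_block_def input_array_def)
  have Ublockv: "block v ''U'' n k = columns A I"
  proof -
    have "reals v ''U'' = reals u ''U''"
      unfolding v_def by (rule reals_run) (simp add: regress_columns_def)
    then show ?thesis using Ublock by (simp add: block_def)
  qed
  have Vblock: "block v ''V'' k m = regress_all reg A I"
    unfolding v_def
    using run_regress_columns[OF sz(1)] Ublock cols A I(2)
    by (intro eq_matI) (auto simp: block_def regress_all_def)
  have Ablock: "block v ''A'' n m = A"
    using inp(2) A by (intro eq_matI) (auto simp: block_def input_array_def)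
  have same: "reals t X = reals v X" if "X \<noteq> ''r''" "X \<noteq> ''d''" for X
    unfolding t by (rule reals_run) (use that in \<open>simp add: compute_error_def\<close>)
  show "block t ''U'' n k = columns A I" "block t ''V'' k m = regress_all reg A I"
    using Ublockv Vblock by (simp_all add: block_def same)
  show "reals t ''d'' 0 0 = subset_error reg p A I"
    unfolding t using run_compute_error[OF sz(2) dims] Ublockv Vblock Ablock
    by (simp add: subset_error_def)
qed

section \<open>Progress of the main loop\<close>

definition tried :: "nat \<Rightarrow> nat \<Rightarrow> nat \<Rightarrow> nat set set" where
  "tried m k x = (\<lambda>y. digit m y ` {..<k}) ` {y. y < x \<and> increasing k (digit m y)}"

lemma tried_0: "tried m k 0 = {}"
  by (simp add: tried_def)

lemma tried_Suc: "tried m k (Suc x) =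
  (if increasing k (digit m x) then insert (digit m x ` {..<k}) (tried m k x) else tried m k x)"
  by (auto simp: tried_def less_Suc_eq)

text \<open>An increasing tuple has distinct entries, so its image has \<open>k\<close> elements.
  Conversely \<open>pick\<close> lists a given set increasingly, and some counter value below
  \<open>m ^ k\<close> has these digits.\<close>

lemma tried_all:
  assumes "0 < m"
  shows "tried m k (m ^ k) = {I. I \<subseteq> {..<m} \<and> card I = k}"
proof
  show "tried m k (m ^ k) \<subseteq> {I. I \<subseteq> {..<m} \<and> card I = k}"
    using assms increasing_inj_on by (auto simp: tried_def card_image digit_less)
  show "{I. I \<subseteq> {..<m} \<and> card I = k} \<subseteq> tried m k (m ^ k)"
  proof
    fix I assume "I \<in> {I. I \<subseteq> {..<m} \<and> card I = k}"
    then have I: "I \<subseteq> {..<m}" "card I = k" "finite I" using finite_subset by auto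
    then have bij: "pick I ` {..<k} = I" using bij_betw_pick[of I] by (simp add: bij_betw_def)
    then have "\<forall>j<k. pick I j < m" using I(1) by auto
    then obtain x where x: "x < m ^ k" "\<forall>j<k. digit m x j = pick I j" using ex_digits by blast
    then have "digit m x ` {..<k} = I" using bij by (metis (no_types, lifting) image_cong lessThan_iff)
    moreover have "increasing k (digit m x)"
      using increasing_pick[OF I(2)] x(2) by (simp add: increasing_def)
    ultimately show "I \<in> tried m k (m ^ k)" using x(1) by (auto simp: tried_def)
  qed
qed

text \<open>The flag \<open>''found''\<close> separates the initial state, where
  \<open>''best''\<close> is not yet the error of any set, from the states with a stored minimizer
  over \<open>T\<close>.\<close>

definition best_of ::
  "(real mat \<Rightarrow> real vec \<Rightarrow> real vec) \<Rightarrow> ereal \<Rightarrow> real mat \<Rightarrow> nat \<Rightarrow> nat \<Rightarrow> nat \<Rightarrow> nat set set \<Rightarrow> store \<Rightarrow> bool" where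
  "best_of reg p A n m k T s \<longleftrightarrow> (T = {} \<and> nats s ''found'' 0 = 0) \<or>
     (\<exists>J\<in>T. nats s ''found'' 0 = 1 \<and> block s ''Ubest'' n k = columns A J \<and>
        block s ''Vbest'' k m = regress_all reg A J \<and> reals s ''best'' 0 0 = subset_error reg p A J \<and>
        (\<forall>I\<in>T. subset_error reg p A J \<le> subset_error reg p A I))"

lemma best_of_run:
  assumes "best_of reg p A n m k T s"
    and "''found'' \<notin> nwrites c" "''Ubest'' \<notin> rwrites c" "''Vbest'' \<notin> rwrites c" "''best'' \<notin> rwrites c"
  shows "best_of reg p A n m k T (run reg c s)"
  using assms(1) unfolding best_of_def block_def
  by (simp only: nats_run[OF assms(2)] reals_run[OF assms(3)] reals_run[OF assms(4)] reals_run[OF assms(5)])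

text \<open>If the flag is 0 then \<open>T\<close> is empty and \<open>I\<close> is trivially best;
  an error strictly below the minimum over \<open>T\<close> is the minimum over the larger family.
  Otherwise the stored set remains minimal, ties being decided for the older one.\<close>

lemma best_of_keep_best:
  assumes s: "sizes n m k s" and best: "best_of reg p A n m k T s"
    and I: "block s ''U'' n k = columns A I" "block s ''V'' k m = regress_all reg A I"
      "reals s ''d'' 0 0 = subset_error reg p A I"
  shows "best_of reg p A n m k (insert I T) (run reg keep_best s)"
proof (cases "nats s ''found'' 0 = 0 \<or> reals s ''d'' 0 0 < reals s ''best'' 0 0")
  case True
  have "\<forall>I'\<in>insert I T. subset_error reg p A I \<le> subset_error reg p A I'"
    using best True I(3) unfolding best_of_def by fastforce
  then show ?thesis using run_keep_best(1)[OF s True, of reg] I unfolding best_of_def by auto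
next
  case False
  then show ?thesis using run_keep_best(2)[OF s False, of reg] best I(3) unfolding best_of_def by auto
qed

definition iteration :: "ereal \<Rightarrow> com" where
  "iteration p = test_increasing ;;
        Cond (NEq (nvar ''ok'') N1)
          (select_columns ;; regress_columns ;; compute_error p ;; keep_best)
          Skip ;;
        next_tuple"

definition loop_invariant ::
  "(real mat \<Rightarrow> real vec \<Rightarrow> real vec) \<Rightarrow> ereal \<Rightarrow> real mat \<Rightarrow> nat \<Rightarrow> nat \<Rightarrow> nat \<Rightarrow> nat \<Rightarrow> store \<Rightarrow> bool" where
  "loop_invariant reg p A n m k x s \<longleftrightarrow> sizes n m k s \<and> input_array n m A s \<and>
     (\<forall>j<k. nats s ''D'' j = digit m x j) \<and> best_of reg p A n m k (tried m k x) s"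

lemmas com_defs = copy_array_def count_tuples_def next_tuple_def test_increasing_def
  select_columns_def regress_columns_def compute_error_def keep_best_def

text \<open>A round either treats the set given by the current digits or skips a tuple that is not
  increasing, which adds nothing to \<open>tried\<close>. Then \<open>next_tuple\<close> advances
  the digits; what else has to be preserved follows from frame conditions.\<close>

lemma loop_invariant_iteration:
  assumes A: "A \<in> carrier_mat n m" and dims: "0 < n" "0 < m"
    and inv: "loop_invariant reg p A n m k x s"
  shows "loop_invariant reg p A n m k (Suc x) (run reg (iteration p) s)"
proof -
  let ?try = "select_columns ;; regress_columns ;; compute_error p"
  let ?branch = "Cond (NEq (nvar ''ok'') N1) (select_columns ;; regress_columns ;; compute_error p ;; keep_best) Skip"
  define u where "u = run reg test_increasing s"
  define v where "v = run reg ?branch u"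
  have s: "sizes n m k s" "input_array n m A s" "\<forall>j<k. nats s ''D'' j = digit m x j"
    "best_of reg p A n m k (tried m k x) s"
    using inv by (auto simp: loop_invariant_def)
  have u: "sizes n m k u" "input_array n m A u" "nats u ''D'' = nats s ''D''"
    "best_of reg p A n m k (tried m k x) u"
    unfolding u_def
    by (rule sizes_run input_array_run nats_run best_of_run; simp add: s com_defs size_vars_def)+
  have v: "sizes n m k v" "input_array n m A v" "nats v ''D'' = nats s ''D''"
    unfolding v_def u(3)[symmetric]
    by (rule sizes_run input_array_run nats_run; simp add: u com_defs size_vars_def)+
  have inc: "increasing k (nats s ''D'') \<longleftrightarrow> increasing k (digit m x)"
    using s(3) by (auto simp: increasing_def)
  have ok: "nats u ''ok'' 0 = 1 \<longleftrightarrow> increasing k (digit m x)"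
    unfolding u_def run_test_increasing[OF s(1)] inc[symmetric] by (simp add: increasing_def)
  have best: "best_of reg p A n m k (tried m k (Suc x)) v"
  proof (cases "increasing k (digit m x)")
    case False
    then show ?thesis using u(4) ok by (simp add: v_def tried_Suc)
  next
    case True
    define w where "w = run reg ?try u"
    have img: "nats u ''D'' ` {..<k} = digit m x ` {..<k}"
      using s(3) u(3) by auto
    have "increasing k (nats u ''D'')" "\<forall>j<k. nats u ''D'' j < m"
      using True inc u(3) s(3) dims by (auto simp: digit_less)
    note w = run_subset[OF u(1,2) A dims this, of reg p, folded w_def, unfolded img]
    have "sizes n m k w" "best_of reg p A n m k (tried m k x) w"
      unfolding w_def
      by (rule sizes_run best_of_run; simp add: u com_defs size_vars_def)+
    from best_of_keep_best[OF this w]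
    show ?thesis using True ok by (simp add: v_def w_def tried_Suc)
  qed
  have "run reg (iteration p) s = run reg next_tuple v"
    by (simp add: iteration_def u_def v_def)
  moreover have "sizes n m k (run reg next_tuple v)" "input_array n m A (run reg next_tuple v)"
    "best_of reg p A n m k (tried m k (Suc x)) (run reg next_tuple v)"
    by (rule sizes_run input_array_run best_of_run; simp add: v best com_defs size_vars_def)+
  moreover have "nats (run reg next_tuple v) ''D'' j = digit m (Suc x) j" if "j < k" for j
    unfolding digit_def
    by (rule run_next_tuple[OF v(1) dims(2) _ that]) (use v(3) s(3) in \<open>simp add: digit_def\<close>)
  ultimately show ?thesis by (simp add: loop_invariant_def)
qed

section \<open>Running time\<close>

definition initialization :: com where
  "initialization = count_tuples ;; For ''j'' (nvar ''k'') (NSet ''D'' (nvar ''j'') N0) ;; ''found'' :=\<^sub>N N0"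

text \<open>Regrouping a sequence changes neither the store nor the total time. This isolates the
  loop with \<open>m ^ k\<close> rounds, the only one that \<open>size_bounded\<close> does not
  cover.\<close>

lemma exec_enumeration: "exec reg reg_time (enumeration p) s =
    (let (s1, t1) = exec reg reg_time initialization s;
         (s2, t2) = exec reg reg_time (For ''x'' (nvar ''count'') (iteration p)) s1
     in (s2, t1 + t2))"
  by (simp add: enumeration_def initialization_def iteration_def split_beta Let_def)

lemma run_initialization:
  assumes s: "sizes n m k s" and A: "input_array n m A s"
  shows "loop_invariant reg p A n m k 0 (run reg initialization s)" "nats (run reg initialization s) ''count'' 0 = m ^ k"
proof -
  define u where "u = run reg count_tuples s"
  define v where "v = run reg (For ''j'' (nvar ''k'') (NSet ''D'' (nvar ''j'') N0)) u"
  have u: "sizes n m k u" "input_array n m A u" "nats u ''count'' 0 = m ^ k"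
    unfolding u_def run_count_tuples[OF s]
    by (rule sizes_run input_array_run refl; simp add: s A com_defs size_vars_def)+
  have v: "sizes n m k v" "input_array n m A v" "nats v ''count'' = nats u ''count''"
    unfolding v_def
    by (rule sizes_run input_array_run nats_run; simp add: u size_vars_def)+
  have "\<forall>j<nval (nvar ''k'') u. nats v ''D'' j = 0"
    unfolding v_def
    by (rule run_For_induct[where I = "\<lambda>a t. \<forall>j<a. nats t ''D'' j = 0"]) (auto simp: less_Suc_eq)
  then have D: "\<forall>j<k. nats v ''D'' j = 0" using u(1) by (simp add: sizes_def)
  have "run reg initialization s = nset ''found'' 0 0 v" by (simp add: initialization_def u_def v_def)
  then show "loop_invariant reg p A n m k 0 (run reg initialization s)" "nats (run reg initialization s) ''count'' 0 = m ^ k"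
    using u v D by (auto simp: loop_invariant_def sizes_def input_array_def digit_def best_of_def tried_0)
qed

lemma run_enumeration_loop:
  assumes A: "A \<in> carrier_mat n m" and dims: "0 < n" "0 < m"
    and inv: "loop_invariant reg p A n m k 0 s" and count: "nats s ''count'' 0 = m ^ k"
  shows "loop_invariant reg p A n m k (m ^ k) (run reg (For ''x'' (nvar ''count'') (iteration p)) s)"
proof -
  have "loop_invariant reg p A n m k (nval (nvar ''count'') s) (run reg (For ''x'' (nvar ''count'') (iteration p)) s)"
  proof (rule run_For_induct[where I = "loop_invariant reg p A n m k"])
    fix x t assume "loop_invariant reg p A n m k x t"
    then have "loop_invariant reg p A n m k x (nset ''x'' 0 x t)"
      by (simp add: loop_invariant_def sizes_def input_array_def best_of_def block_def)
    then show "loop_invariant reg p A n m k (Suc x) (run reg (iteration p) (nset ''x'' 0 x t))"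
      by (rule loop_invariant_iteration[OF A dims])
  qed (rule inv)
  then show ?thesis using count by simp
qed

lemma best_of_enumeration_output:
  assumes p: "1 \<le> p" and reg: "regression_solver p reg" and A: "A \<in> carrier_mat n m"
    and dims: "0 < n" "0 < k" "k \<le> m"
    and best: "best_of reg p A n m k {I. I \<subseteq> {..<m} \<and> card I = k} s"
  shows "enumeration_output k p A (block s ''Ubest'' n k) (block s ''Vbest'' k m)"
proof -
  have dimA: "dim_col A = m" using A by simp
  have "{..<k} \<in> {I. I \<subseteq> {..<m} \<and> card I = k}" using dims by auto
  then have "{I. I \<subseteq> {..<m} \<and> card I = k} \<noteq> {}" by blast
  then obtain J where J: "J \<subseteq> {..<m}" "card J = k" "block s ''Ubest'' n k = columns A J"
    "block s ''Vbest'' k m = regress_all reg A J"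
    "\<And>I. I \<subseteq> {..<m} \<and> card I = k \<Longrightarrow> subset_error reg p A J \<le> subset_error reg p A I"
    using best unfolding best_of_def by blast
  show ?thesis
    unfolding enumeration_output_def dimA
  proof (intro exI[of _ "regress_all reg A"] exI[of _ J] conjI allI impI)
    fix I assume "I \<subseteq> {..<m} \<and> card I = k"
    then show "is_arg_min (\<lambda>W. mat_norm p (A - columns A I * W)) (\<lambda>W. W \<in> carrier_mat k m) (regress_all reg A I)"
      using dims by (intro regress_all_minimizer[OF p reg A]) auto
  next
    show "is_arg_min (\<lambda>I. mat_norm p (A - columns A I * regress_all reg A I)) (\<lambda>I. I \<subseteq> {..<m} \<and> card I = k) J"
      unfolding is_arg_min_linorder using J(1,2,5) by (auto simp: subset_error_def)
  qed (use J in auto)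
qed

lemma size_bounded_initialization: "size_bounded initialization" "nwrites initialization \<inter> size_vars = {}"
  by (auto simp: initialization_def com_defs size_vars_def)

lemma size_bounded_iteration: "size_bounded (iteration p)" "nwrites (iteration p) \<inter> size_vars = {}"
  by (auto simp: iteration_def com_defs size_vars_def)

text \<open>Initialization and every round obey \<open>cost_bound\<close>. Entering the outer loop
  costs 3 units and each round 1 more; as \<open>m ^ k\<close> is at least 1, the one-time costs can
  be multiplied by it as well, which gives the constant 4.\<close>

lemma enumeration_time:
  assumes "n \<le> N" "m \<le> N" "k \<le> N" "0 < m"
    and reg_time: "\<And>U v. U \<in> carrier_mat n k \<Longrightarrow> v \<in> carrier_vec n \<Longrightarrow> reg_time U v \<le> R"
    and s: "sizes n m k s"
  shows "snd (exec reg reg_time (enumeration p) s)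
    \<le> m ^ k * (cost_bound N R initialization + cost_bound N R (iteration p) + 4)"
proof -
  note bound = snd_exec_le[of n N m k reg_time R, OF assms(1-3) reg_time]
  let ?L = "For ''x'' (nvar ''count'') (iteration p)"
  let ?s = "run reg initialization s"
  let ?B = "cost_bound N R (iteration p)"
  have initialization: "snd (exec reg reg_time initialization s) \<le> cost_bound N R initialization"
    by (rule bound) (auto simp: s size_bounded_initialization)
  have s': "sizes n m k ?s" by (rule sizes_run[OF s size_bounded_initialization(2)])
  have count: "nats ?s ''count'' 0 = m ^ k"
  proof -
    have "nats ?s ''count'' 0 = nats (run reg count_tuples s) ''count'' 0"
      unfolding initialization_def run_simps by (simp add: nats_run)
    then show ?thesis using run_count_tuples[OF s] by simp
  qed
  have x: "sizes n m k (nset ''x'' 0 i t)" if "sizes n m k t" for i t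
    using that by (simp add: sizes_def)
  have "snd (exec reg reg_time ?L ?s) \<le> 1 + ncost (nvar ''count'') + nval (nvar ''count'') ?s * (1 + ?B)"
  proof (rule snd_exec_For_le[where I = "sizes n m k"])
    fix i t assume "sizes n m k t"
    note x = x[OF this]
    show "sizes n m k (run reg (iteration p) (nset ''x'' 0 i t))"
      by (rule sizes_run[OF x size_bounded_iteration(2)])
    show "snd (exec reg reg_time (iteration p) (nset ''x'' 0 i t)) \<le> ?B"
      by (rule bound) (simp_all add: x size_bounded_iteration)
  qed (rule s')
  then have loop: "snd (exec reg reg_time ?L ?s) \<le> 3 + m ^ k * (1 + ?B)"
    using count by simp
  have "1 \<le> m ^ k" using assms(4) by simp
  then have "cost_bound N R initialization + 3 \<le> m ^ k * (cost_bound N R initialization + 3)" by simp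
  then show ?thesis
    using initialization loop by (simp add: exec_enumeration split_beta Let_def fst_exec algebra_simps)
qed

text \<open>All sizes are at most \<open>n * m\<close>, so this product serves as \<open>N\<close>.
  A regression instance has \<open>n * k + n\<close> entries, at most twice \<open>n * m\<close>;
  hence the substitution of \<open>2 * N\<close> into the polynomial \<open>q0\<close> of the
  solver.\<close>

lemma enumeration_time_poly:
  assumes "polynomial_time_regression reg_time"
  shows "\<exists>q :: nat poly. \<forall>n m k s. 0 < k \<longrightarrow> k \<le> m \<longrightarrow> m \<le> n \<longrightarrow> sizes n m k s \<longrightarrow>
    snd (exec reg reg_time (enumeration p) s) \<le> m ^ k * poly q (n * m)"
proof -
  obtain q0 :: "nat poly" where q0: "\<And>n k U v. 0 < n \<Longrightarrow> 0 < k \<Longrightarrow>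
        U \<in> carrier_mat n k \<Longrightarrow> v \<in> carrier_vec n \<Longrightarrow> reg_time U v \<le> poly q0 (n * k + n)"
    using assms unfolding polynomial_time_regression_def by blast
  define r where "r = pcompose q0 [:0, 2:]"
  obtain q1 q2 where q: "\<And>N. cost_bound N (poly r N) initialization = poly q1 N"
    "\<And>N. cost_bound N (poly r N) (iteration p) = poly q2 N"
    using cost_bound_poly by metis
  have "snd (exec reg reg_time (enumeration p) s) \<le> m ^ k * poly (q1 + q2 + [:4:]) (n * m)"
    if dims: "0 < k" "k \<le> m" "m \<le> n" and s: "sizes n m k s" for n m k s
  proof -
    have "1 \<le> n" "1 \<le> m" using dims by auto
    then have N: "n \<le> n * m" "m \<le> n * m" "k \<le> n * m" using dims by (auto intro: order_trans)
    have "n * k + n \<le> n * m * 2"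
      using N(1) mult_le_mono2[OF dims(2), of n] by linarith
    then have "poly q0 (n * k + n) \<le> poly r (n * m)"
      unfolding r_def poly_pcompose by (auto intro!: poly_nat_mono)
    then have "reg_time U v \<le> poly r (n * m)" if "U \<in> carrier_mat n k" "v \<in> carrier_vec n" for U v
      using q0[of n k U v] that dims by (meson le_trans less_le_trans)
    from enumeration_time[where reg = reg and p = p, OF N _ this s] show ?thesis
      using dims by (simp add: q)
  qed
  then show ?thesis by blast
qed

theorem theorem4:
  fixes p :: ereal
    and reg :: "real mat \<Rightarrow> real vec \<Rightarrow> real vec"
    and reg_time :: "real mat \<Rightarrow> real vec \<Rightarrow> nat"
  assumes "1 \<le> p"
    and "regression_solver p reg"
    and "polynomial_time_regression reg_time"
  shows "\<exists>q :: nat poly. \<forall>(n :: nat) (m :: nat) (k :: nat) (A :: real mat).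
    1 \<le> k \<longrightarrow> k \<le> m \<longrightarrow> m \<le> n \<longrightarrow> A \<in> carrier_mat n m \<longrightarrow>
      (let (s, t) = exec reg reg_time (enumeration p) (input_store n m k A);
           U = block s ''Ubest'' n k;
           V = block s ''Vbest'' k m
       in t \<le> m ^ k * poly q (n * m) \<and>
          enumeration_output k p A U V \<and>
          mat_norm p (A - U * V) \<le> (real k + 1) * opt k p A) \<and>
      (\<forall>U V. enumeration_output k p A U V \<longrightarrow>
          mat_norm p (A - U * V) \<le> (real k + 1) * opt k p A)"
proof -
  \<comment> \<open>The time bound holds for every store with the right sizes, so \<open>q\<close>
    can be fixed before the matrix and its dimensions.\<close>
  obtain q :: "nat poly" where q: "\<And>n m k s. 0 < k \<Longrightarrow> k \<le> m \<Longrightarrow> m \<le> n \<Longrightarrow> sizes n m k s \<Longrightarrow>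
    snd (exec reg reg_time (enumeration p) s) \<le> m ^ k * poly q (n * m)"
    using enumeration_time_poly[where reg = reg and p = p, OF assms(3)] by blast
  show ?thesis
  proof (intro exI[of _ q] allI impI)
    fix n m k :: nat and A :: "real mat"
    assume dims: "1 \<le> k" "k \<le> m" "m \<le> n" and A: "A \<in> carrier_mat n m"
    then have pos: "0 < k" "0 < m" "0 < n" by auto
    let ?s = "input_store n m k A"
    define s where "s = run reg (enumeration p) ?s"
    have inp: "sizes n m k ?s" "input_array n m A ?s"
      by (simp_all add: sizes_def input_array_def input_store_def)
    have "s = run reg (For ''x'' (nvar ''count'') (iteration p)) (run reg initialization ?s)"
      unfolding s_def run_def exec_enumeration by (simp add: split_beta Let_def)
    then have "loop_invariant reg p A n m k (m ^ k) s"
      using run_enumeration_loop[OF A pos(3,2) run_initialization[OF inp]] by simp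
    \<comment> \<open>After \<open>m ^ k\<close> rounds every set of \<open>k\<close> column indices
      has been tried.\<close>
    then have "best_of reg p A n m k {I. I \<subseteq> {..<m} \<and> card I = k} s"
      by (simp add: loop_invariant_def tried_all[OF pos(2)])
    then have out: "enumeration_output k p A (block s ''Ubest'' n k) (block s ''Vbest'' k m)"
      by (rule best_of_enumeration_output[OF assms(1,2) A pos(3,1) dims(2)])
    \<comment> \<open>The approximation bound holds however minimizers are chosen and ties are
      broken; the result of the machine is a special case.\<close>
    have bound: "\<forall>U V. enumeration_output k p A U V \<longrightarrow> mat_norm p (A - U * V) \<le> (real k + 1) * opt k p A"
      using enumeration_output_bound[OF assms(1) pos(1) dims(2) pos(3) A] by blast
    have "fst (exec reg reg_time (enumeration p) ?s) = s"
      by (simp add: s_def fst_exec)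
    then show "(let (s, t) = exec reg reg_time (enumeration p) ?s;
           U = block s ''Ubest'' n k;
           V = block s ''Vbest'' k m
       in t \<le> m ^ k * poly q (n * m) \<and>
          enumeration_output k p A U V \<and>
          mat_norm p (A - U * V) \<le> (real k + 1) * opt k p A) \<and>
      (\<forall>U V. enumeration_output k p A U V \<longrightarrow>
          mat_norm p (A - U * V) \<le> (real k + 1) * opt k p A)"
      using q[OF pos(1) dims(2,3) inp(1)] out bound by (simp add: Let_def split_beta)
  qed
qed

end
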